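(* Suppose that $\mathsf{E}\{\xi\}=0$ and $\mathsf{E}\{\xi^2\}=1$, and that $x\mapsto F(x+\Delta)$ is intermediate regularly varying at infinity (hence $O$-regularly varying), with upper Matuszewska index $\alpha_F$ and lower Matuszewska index $\beta_F$. 1. If $T=\infty$, suppose that $\alpha_F<-2$, and let $t>-\beta_F-2$. 2. If $T<\infty$, suppose that $\alpha_F<-3$, and let $t>-\beta_F-3$. Then $\mathsf{P}\{S_n\in x+\Delta\}\sim nF(x+\Delta)$ as $n\to\infty$ uniformly for $x\ge\sqrt{tn\log n}$, that is, $$\lim_{n\to\infty}\ \sup_{x\ge\sqrt{tn\log n}}\left|\frac{\mathsf{P}\{S_n\in x+\Delta\}}{nF(x+\Delta)}-1\right|=0 .$$
   Context: Let $\xi,\xi_1,\xi_2,\dots$ be i.i.d. real random variables with distribution $F$, and $S_n=\xi_1+\cdots+\xi_n$. Fix $T\in(0,\infty]$; put $\Delta=(0,T]$ if $T<\infty$ and $\Delta=(0,\infty)$ if $T=\infty$, and $F(x+\Delta)=\mathsf{P}\{\xi\in x+\Delta\}$ (so $F(x+\Delta)=\mathsf{P}\{\xi>x\}$ when $T=\infty$). Let $f$ be a positive measurable function defined near infinity. It is $O$-regularly varying if $0<\liminf_{x\to\infty}f(xy)/f(x)\le\limsup_{x\to\infty}f(xy)/f(x)<\infty$ for every $y\ge1$. Its upper Matuszewska index $\alpha_f$ is the infimum of those $\alpha\in\mathbb{R}$ for which there is $C=C(\alpha)$ such that for every $Y>1$, $f(xy)/f(x)\le C(1+o(1))y^\alpha$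 as $x\to\infty$ uniformly in $y\in[1,Y]$; its lower Matuszewska index $\beta_f$ is the supremum of those $\beta\in\mathbb{R}$ for which there is $D=D(\beta)>0$ such that for every $Y>1$, $f(xy)/f(x)\ge D(1+o(1))y^\beta$ as $x\to\infty$ uniformly in $y\in[1,Y]$. Both are finite for $O$-regularly varying $f$. The function $f$ is intermediate regularly varying if $\lim_{y\downarrow1}\liminf_{x\to\infty}f(xy)/f(x)=\lim_{y\downarrow1}\limsup_{x\to\infty}f(xy)/f(x)=1$; this implies $O$-regular variation. Here $\alpha_F,\beta_F$ denote the indices of $f(x)=F(x+\Delta)$. *)

theory Defs
  imports "HOL-Probability.Probability"
begin

definition Delta :: "ereal \<Rightarrow> real set" where
  "Delta T = {s. 0 < s \<and> ereal s \<le> T}"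

lemma Delta_infinity: "Delta \<infinity> = {0<..}"
  by (auto simp: Delta_def)

lemma Delta_finite: "Delta (ereal r) = {0<..r}"
  by (auto simp: Delta_def)

text \<open>The value \<open>F (x + \<Delta>)\<close> for a distribution \<open>F\<close> on the real line.\<close>

definition window :: "real measure \<Rightarrow> ereal \<Rightarrow> real \<Rightarrow> real" where
  "window F T x = measure F ((+) x ` Delta T)"

definition pos_measurable_near_infinity :: "(real \<Rightarrow> real) \<Rightarrow> bool" where
  "pos_measurable_near_infinity f \<longleftrightarrow>
     (\<exists>a. (\<forall>x\<ge>a. 0 < f x) \<and> f \<in> borel_measurable (restrict_space borel {a..}))"

text \<open>The lower and upper limits are taken in the extended reals, so that an infinite
  upper limit is not replaced by an arbitrary real number.\<close>

definition intermediate_regularly_varying :: "(real \<Rightarrow> real) \<Rightarrow> bool" where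
  "intermediate_regularly_varying f \<longleftrightarrow>
     pos_measurable_near_infinity f \<and>
     ((\<lambda>y. Liminf at_top (\<lambda>x. ereal (f (x * y) / f x))) \<longlongrightarrow> 1) (at_right 1) \<and>
     ((\<lambda>y. Limsup at_top (\<lambda>x. ereal (f (x * y) / f x))) \<longlongrightarrow> 1) (at_right 1)"

text \<open>In both indices, the \<open>o(1)\<close> term being uniform in \<open>y \<in> [1, Y]\<close> is expressed by an
  error \<open>\<epsilon>\<close> that depends on \<open>x\<close> (and on \<open>Y\<close>) but not on \<open>y\<close>. The constants \<open>C\<close> and \<open>D\<close> are
  chosen before \<open>Y\<close>. The indices are extended reals because the infimum or supremum
  need not be finite for an arbitrary \<open>f\<close>.\<close>

definition upper_Matuszewska_index :: "(real \<Rightarrow> real) \<Rightarrow> ereal" where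
  "upper_Matuszewska_index f =
     Inf (ereal ` {\<alpha>. \<exists>C. \<forall>Y>1. \<exists>\<epsilon>. (\<epsilon> \<longlongrightarrow> 0) at_top \<and>
       (\<forall>\<^sub>F x in at_top. \<forall>y\<in>{1..Y}. f (x * y) / f x \<le> C * (1 + \<epsilon> x) * y powr \<alpha>)})"

definition lower_Matuszewska_index :: "(real \<Rightarrow> real) \<Rightarrow> ereal" where
  "lower_Matuszewska_index f =
     Sup (ereal ` {\<beta>. \<exists>D>0. \<forall>Y>1. \<exists>\<epsilon>. (\<epsilon> \<longlongrightarrow> 0) at_top \<and>
       (\<forall>\<^sub>F x in at_top. \<forall>y\<in>{1..Y}. f (x * y) / f x \<ge> D * (1 + \<epsilon> x) * y powr \<beta>)})"

end

theory Submission
  imports Defs "HOL-Real_Asymp.Real_Asymp"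
begin

text \<open>A single large step accounts for the whole probability. Conditionally on the other steps, the step
  exceeding \<open>\<delta> * x\<close> falls into a window \<open>x - s + \<Delta>\<close>, where \<open>s\<close> is the sum of the others; by
  Chebyshev's inequality \<open>s\<close> is \<open>o(x)\<close> with high probability, and then intermediate regular
  variation replaces \<open>F(x - s + \<Delta>)\<close> by \<open>F(x + \<Delta>)\<close>. For the lower bound, the events that one
  step exceeds \<open>x / 2\<close> and all others do not are disjoint.

  It remains to show that the event that all steps are at most \<open>\<delta> * x\<close> is negligible. An exponential
  change of measure bounds its probability by \<open>exp (- (1 - o(1)) * x\<^sup>2 / (2 * n))\<close> up to the range
  \<open>x\<^sup>2 = A * n * ln x\<close>, and by an arbitrary power of \<open>1 / x\<close> beyond it. For finite \<open>T\<close>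
  the first bound improves by a factor \<open>1 / sqrt n\<close>, by a concentration inequality for the tilted law.
  At \<open>x\<^sup>2 = t * n * ln n\<close> this is smaller than \<open>n * F(x + \<Delta>)\<close> by a power of \<open>n\<close>, precisely
  because \<open>F(x + \<Delta>)\<close> is bounded below by \<open>x powr (- b)\<close> with \<open>b < t + 2\<close>, respectively
  \<open>b < t + 3\<close>.\<close>

section \<open>Intermediate regular variation\<close>

text \<open>Only two moments are assumed and \<open>F\<close> may be lattice, so neither exponential
  moments nor a local limit theorem is at hand. Cutting the steps at \<open>\<delta> * x\<close>
  makes exponential weights integrable, but a step near the cut then weighs up to
  \<open>x powr (\<delta> * A)\<close>. With \<open>n \<le> x\<^sup>2\<close> such steps contribute
  about \<open>x powr (2 + q + \<delta> * A + \<alpha>)\<close>, up to logarithms, where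
  \<open>q\<close> is 0 for \<open>T = \<infinity>\<close> and 1 otherwise. Hence the upper index
  has to lie below \<open>- 2 - q\<close>: the extra unit for finite \<open>T\<close> is the cost of
  covering an interval of length \<open>x\<close> by windows of fixed length. The threshold for
  \<open>t\<close> comes from comparing \<open>n powr (- q / 2 - \<rho> * t / 2)\<close> with
  \<open>n * x powr (- b)\<close> at \<open>x\<^sup>2\<close> of order \<open>n * ln n\<close>,
  which requires \<open>b < \<rho> * t + 2 + q\<close>. Since the inequality for \<open>t\<close> is
  strict, some \<open>\<rho> < 1\<close> suffices. So the Gaussian exponent must be asymptotically
  sharp, while multiplicative constants and logarithms are absorbed by the spare power of
  \<open>n\<close>; this is why crude constants do everywhere below.\<close>

lemma le_mult_ge_one:
  fixes x y :: real
  assumes "a \<le> x" "0 \<le> x" "1 \<le> y"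
  shows "a \<le> x * y"
  using mult_left_mono[of 1 y x] assms by linarith

section \<open>Potter bounds from the Matuszewska indices\<close>

lemma potter_bound:
  fixes g :: "real \<Rightarrow> real"
  assumes pos: "\<And>x. x \<ge> a \<Longrightarrow> 0 < g x" and K: "0 < K" and pr: "p < r"
    and loc: "\<And>Y. Y > 1 \<Longrightarrow> \<forall>\<^sub>F x in at_top. \<forall>y\<in>{1..Y}. g (x * y) \<le> K * y powr p * g x"
  shows "\<forall>\<^sub>F x in at_top. \<forall>y\<ge>1. g (x * y) \<le> K * y powr r * g x"
proof -
  \<comment> \<open>Iterating the local bound costs one factor \<open>K\<close> per step. This
    \<open>Y\<close> is so large that \<open>K * Y powr p \<le> Y powr r\<close>: a full step by
    \<open>Y\<close> hides the constant in the larger exponent, and \<open>K\<close> is paid only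
    once, for the last incomplete step.\<close>
  define Y where "Y = max 2 (K powr (1 / (r - p)))"
  have Y: "Y > 1" "Y > 0" by (auto simp: Y_def)
  have "K = (K powr (1 / (r - p))) powr (r - p)"
    using K pr by (simp add: powr_powr)
  also have "\<dots> \<le> Y powr (r - p)"
    using pr by (intro powr_mono2) (auto simp: Y_def)
  finally have "K * Y powr p \<le> Y powr (r - p) * Y powr p"
    by (intro mult_right_mono) auto
  then have KY: "K * Y powr p \<le> Y powr r"
    by (simp flip: powr_add)
  obtain X0 where X0: "\<And>x y. x \<ge> X0 \<Longrightarrow> y \<in> {1..Y} \<Longrightarrow> g (x * y) \<le> K * y powr p * g x"
    using loc[OF Y(1)] unfolding eventually_at_top_linorder by blast
  define X where "X = max X0 (max a 1)"
  have X: "g x > 0" "y \<in> {1..Y} \<Longrightarrow> g (x * y) \<le> K * y powr p * g x" "x > 0"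
    if "x \<ge> X" for x y using that X0[of x y] pos[of x] by (auto simp: X_def)
  have main: "\<forall>x\<ge>X. \<forall>y. 1 \<le> y \<and> y \<le> Y ^ k \<longrightarrow> g (x * y) \<le> K * y powr r * g x" for k
  proof (induction k)
    case 0
    then show ?case using X(2)[of _ 1] Y by (auto simp: order_antisym_conv)
  next
    case (Suc k)
    show ?case
    proof (intro allI impI)
      fix x y assume x: "X \<le> x" and y: "1 \<le> y \<and> y \<le> Y ^ Suc k"
      show "g (x * y) \<le> K * y powr r * g x"
      proof (cases "y \<le> Y")
        case True
        have "g (x * y) \<le> K * y powr p * g x" using X x y True by auto
        also have "\<dots> \<le> K * y powr r * g x"
          using K y pr X[OF x] by (intro mult_right_mono mult_left_mono powr_mono) auto
        finally show ?thesis .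
      next
        case False
        have xY: "x * Y \<ge> X"
          using x X(3)[OF x] Y by (metis le_less_trans less_le mult.right_neutral mult_left_mono order.trans)
        have "g (x * Y * (y / Y)) \<le> K * (y / Y) powr r * g (x * Y)"
        proof -
          have "1 \<le> y / Y" "y / Y \<le> Y ^ k" using False Y y by (auto simp: field_simps)
          then show ?thesis using Suc xY by blast
        qed
        also have "\<dots> \<le> K * (y / Y) powr r * (Y powr r * g x)"
        proof (intro mult_left_mono)
          have "g (x * Y) \<le> K * Y powr p * g x" using X(2)[OF x] Y by auto
          also have "\<dots> \<le> Y powr r * g x" using KY X(1)[OF x] by (intro mult_right_mono) auto
          finally show "g (x * Y) \<le> Y powr r * g x" .
        qed (use K in auto)
        also have "\<dots> = K * y powr r * g x"
          using Y y by (simp add: powr_divide)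
        finally show ?thesis using Y by simp
      qed
    qed
  qed
  have "\<forall>x\<ge>X. \<forall>y\<ge>1. g (x * y) \<le> K * y powr r * g x"
  proof (intro allI impI)
    fix x y :: real assume "X \<le> x" "1 \<le> y"
    obtain k where "y < Y ^ k" using real_arch_pow[OF Y(1)] by blast
    then show "g (x * y) \<le> K * y powr r * g x"
      using main[of k] \<open>X \<le> x\<close> \<open>1 \<le> y\<close> by auto
  qed
  then show ?thesis by (auto simp: eventually_at_top_linorder)
qed

lemma upper_Matuszewska_potter:
  assumes pos: "\<And>x. x \<ge> a \<Longrightarrow> 0 < f x" and idx: "upper_Matuszewska_index f < ereal r"
  shows "\<exists>K>0. \<forall>\<^sub>F x in at_top. \<forall>y\<ge>1. f (x * y) \<le> K * y powr r * f x"
proof -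
  from idx obtain p C where pr: "p < r"
    and C: "\<forall>Y>1. \<exists>\<epsilon>. (\<epsilon> \<longlongrightarrow> 0) at_top \<and>
       (\<forall>\<^sub>F x in at_top. \<forall>y\<in>{1..Y}. f (x * y) / f x \<le> C * (1 + \<epsilon> x) * y powr p)"
    unfolding upper_Matuszewska_index_def Inf_less_iff by auto
  \<comment> \<open>The definition of the index puts no sign on \<open>C\<close>, hence the maximum;
    the factor 2 absorbs \<open>1 + \<epsilon> x\<close>.\<close>
  define K where "K = 2 * max 1 C"
  have "\<forall>\<^sub>F x in at_top. \<forall>y\<ge>1. f (x * y) \<le> K * y powr r * f x"
  proof (rule potter_bound[OF pos _ pr])
    show "0 < K" by (auto simp: K_def)
    fix Y :: real assume "Y > 1"
    with C obtain \<epsilon> where e: "(\<epsilon> \<longlongrightarrow> 0) at_top"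
      "\<forall>\<^sub>F x in at_top. \<forall>y\<in>{1..Y}. f (x * y) / f x \<le> C * (1 + \<epsilon> x) * y powr p" by blast
    have "\<forall>\<^sub>F x in at_top. \<bar>\<epsilon> x\<bar> < 1"
      using e(1) by (auto simp: tendsto_iff dist_real_def)
    with e(2) eventually_ge_at_top[of a]
    show "\<forall>\<^sub>F x in at_top. \<forall>y\<in>{1..Y}. f (x * y) \<le> K * y powr p * f x"
    proof eventually_elim
      case (elim x)
      show ?case
      proof
        fix y assume y: "y \<in> {1..Y}"
        have "C * (1 + \<epsilon> x) \<le> max 1 C * 2"
          using elim by (intro mult_mono) auto
        then have "C * (1 + \<epsilon> x) * y powr p \<le> K * y powr p"
          by (intro mult_right_mono) (auto simp: K_def)
        moreover have "f (x * y) / f x \<le> C * (1 + \<epsilon> x) * y powr p" using elim y by blast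
        ultimately have "f (x * y) / f x \<le> K * y powr p" by linarith
        then show "f (x * y) \<le> K * y powr p * f x"
          using pos[of x] elim by (simp add: field_simps)
      qed
    qed
  qed auto
  then show ?thesis by (intro exI[of _ K]) (auto simp: K_def)
qed

text \<open>Reciprocals turn lower bounds into upper ones, so \<open>potter_bound\<close> applies to
  \<open>1 / f\<close> with negated exponents. The 2 in \<open>2 / D\<close> compensates
  \<open>1 + \<epsilon> x\<close>, which is eventually at least \<open>1 / 2\<close>.\<close>

lemma lower_Matuszewska_potter:
  assumes pos: "\<And>x. x \<ge> a \<Longrightarrow> 0 < f x" and idx: "ereal r < lower_Matuszewska_index f"
  shows "\<exists>D>0. \<forall>\<^sub>F x in at_top. \<forall>y\<ge>1. D * y powr r * f x \<le> f (x * y)"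
proof -
  from idx obtain p D where pr: "r < p" and D: "D > 0"
    "\<forall>Y>1. \<exists>\<epsilon>. (\<epsilon> \<longlongrightarrow> 0) at_top \<and>
       (\<forall>\<^sub>F x in at_top. \<forall>y\<in>{1..Y}. f (x * y) / f x \<ge> D * (1 + \<epsilon> x) * y powr p)"
    unfolding lower_Matuszewska_index_def less_Sup_iff by auto
  have "\<forall>\<^sub>F x in at_top. \<forall>y\<ge>1. 1 / f (x * y) \<le> 2 / D * y powr (- r) * (1 / f x)"
  proof (rule potter_bound[where a = a and g = "\<lambda>x. 1 / f x" and p = "- p"])
    show "0 < 2 / D" "- p < - r" using pr D by auto
    fix Y :: real assume "Y > 1"
    with D obtain \<epsilon> where e: "(\<epsilon> \<longlongrightarrow> 0) at_top"
      "\<forall>\<^sub>F x in at_top. \<forall>y\<in>{1..Y}. f (x * y) / f x \<ge> D * (1 + \<epsilon> x) * y powr p" by blast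
    have "\<forall>\<^sub>F x in at_top. \<bar>\<epsilon> x\<bar> < 1 / 2"
      using tendstoD[OF e(1), of "1 / 2"] by (simp add: dist_real_def)
    with e(2) eventually_ge_at_top[of "max a 1"]
    show "\<forall>\<^sub>F x in at_top. \<forall>y\<in>{1..Y}. 1 / f (x * y) \<le> 2 / D * y powr (- p) * (1 / f x)"
    proof eventually_elim
      case (elim x)
      show ?case
      proof
        fix y assume y: "y \<in> {1..Y}"
        have "a \<le> x * y" by (rule le_mult_ge_one) (use elim y in auto)
        then have fp: "f x > 0" "f (x * y) > 0" using elim by (auto intro!: pos)
        have "D * (1 / 2) * y powr p \<le> D * (1 + \<epsilon> x) * y powr p"
          using elim D by (intro mult_right_mono mult_left_mono) auto
        moreover have "D * (1 + \<epsilon> x) * y powr p \<le> f (x * y) / f x" using elim y by blast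
        ultimately have "D * (1 / 2) * y powr p \<le> f (x * y) / f x" by linarith
        then show "1 / f (x * y) \<le> 2 / D * y powr (- p) * (1 / f x)"
          using fp D y by (simp add: field_simps powr_minus)
      qed
    qed
  qed (use pos in auto)
  with eventually_ge_at_top[of "max a 1"]
  have "\<forall>\<^sub>F x in at_top. \<forall>y\<ge>1. D / 2 * y powr r * f x \<le> f (x * y)"
  proof eventually_elim
    case (elim x)
    show ?case
    proof (intro allI impI)
      fix y :: real assume y: "y \<ge> 1"
      have "a \<le> x * y" by (rule le_mult_ge_one) (use elim y in auto)
      then have fp: "f x > 0" "f (x * y) > 0" using elim by (auto intro!: pos)
      show "D / 2 * y powr r * f x \<le> f (x * y)"
        using elim(2)[rule_format, OF y] elim fp D y by (simp add: field_simps powr_minus)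
    qed
  qed
  then show ?thesis using D by (intro exI[of _ "D / 2"]) auto
qed

section \<open>Uniformity in intermediate regular variation\<close>

text \<open>The limits in the definition are pointwise in the multiplier. As in the uniform convergence
  theorem for regular variation, for large \<open>n\<close> the set of good multipliers from \<open>x n\<close> and the one
  from \<open>x n * y n\<close>, rescaled by \<open>y n\<close>, are too large to be disjoint, and a common
  element compares \<open>f (x n * y n)\<close> with \<open>f (x n)\<close>.\<close>

lemma irv_uniform:
  assumes irv: "intermediate_regularly_varying f" and e: "e > 0"
  shows "\<exists>d>0. \<forall>\<^sub>F x in at_top. \<forall>y\<in>{1..1+d}. \<bar>f (x * y) / f x - 1\<bar> \<le> e"
proof -
  from irv obtain a0 where a0: "\<And>x. x \<ge> a0 \<Longrightarrow> 0 < f x"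
    and meas0: "f \<in> borel_measurable (restrict_space borel {a0..})"
    unfolding intermediate_regularly_varying_def pos_measurable_near_infinity_def by blast
  \<comment> \<open>Changing \<open>f\<close> below \<open>a0\<close> yields a positive Borel
    function on the whole line with the same ratios far out, so the sets of good multipliers become
    Borel.\<close>
  define g where "g x = (if x \<in> {a0..} then f x else 1)" for x
  have gpos: "g x > 0" for x using a0 by (auto simp: g_def)
  have [measurable]: "g \<in> borel_measurable borel"
    unfolding g_def using meas0 by (subst measurable_If_restrict_space_iff) (auto simp del: atLeast_iff)
  \<comment> \<open>With \<open>h \<le> 1/3\<close>, a quotient of two numbers within
    \<open>h\<close> of 1 is within \<open>3 * h\<close> of 1, because the denominator is at least
    \<open>2/3\<close>.\<close>
  define h where "h = min (1/3) (e / 3)"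
  have h: "0 < h" "h \<le> 1/3" "3 * h \<le> e" using e by (auto simp: h_def)
  have "\<forall>\<^sub>F y in at_right 1. Liminf at_top (\<lambda>x. ereal (f (x * y) / f x)) > ereal (1 - h)"
    using irv h unfolding intermediate_regularly_varying_def
    by (intro order_tendstoD(1)[where y = 1]) (auto simp: one_ereal_def)
  moreover have "\<forall>\<^sub>F y in at_right 1. Limsup at_top (\<lambda>x. ereal (f (x * y) / f x)) < ereal (1 + h)"
    using irv h unfolding intermediate_regularly_varying_def
    by (intro order_tendstoD(2)[where y = 1]) (auto simp: one_ereal_def)
  ultimately have "\<forall>\<^sub>F y in at_right 1. \<forall>\<^sub>F x in at_top. \<bar>f (x * y) / f x - 1\<bar> \<le> h"
  proof eventually_elim
    case (elim y)
    from less_LiminfD[OF elim(1)] Limsup_lessD[OF elim(2)]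
    show ?case by eventually_elim auto
  qed
  then obtain b where b: "b > 1" and bl: "\<And>y. 1 < y \<Longrightarrow> y < b \<Longrightarrow> \<forall>\<^sub>F x in at_top. \<bar>f (x * y) / f x - 1\<bar> \<le> h"
    unfolding eventually_at_right_field by auto
  have blg: "\<forall>\<^sub>F x in at_top. \<bar>g (x * y) / g x - 1\<bar> \<le> h" if "y \<in> {1<..<b}" for y
  proof -
    have "\<forall>\<^sub>F x in at_top. \<bar>f (x * y) / f x - 1\<bar> \<le> h" using bl that by auto
    then show ?thesis using eventually_ge_at_top[of "max a0 1"]
    proof eventually_elim
    case (elim x)
    have "a0 \<le> x * y" by (rule le_mult_ge_one) (use elim that in auto)
    with elim show ?case by (simp add: g_def)
    qed
  qed
  show ?thesis
  proof (rule ccontr)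
    assume "\<not> ?thesis"
    then have nex: "\<exists>x\<ge>X. \<exists>y\<in>{1..1 + d}. \<not> \<bar>f (x * y) / f x - 1\<bar> \<le> e" if "d > 0" for d X
      using that unfolding eventually_at_top_linorder by blast
    have "\<exists>x y. real n \<le> x \<and> max a0 1 \<le> x \<and> y \<in> {1..1 + 1 / real (Suc n)} \<and> \<bar>f (x * y) / f x - 1\<bar> > e" for n
    proof -
      obtain x y where "x \<ge> max (real n) (max a0 1)" "y \<in> {1..1 + 1 / real (Suc n)}"
        "\<not> \<bar>f (x * y) / f x - 1\<bar> \<le> e"
        using nex[of "1 / real (Suc n)" "max (real n) (max a0 1)"] by auto
      then show ?thesis by (intro exI[of _ x] exI[of _ y]) auto
    qed
    then have "\<forall>n. \<exists>x y. real n \<le> x \<and> max a0 1 \<le> x \<and> y \<in> {1..1 + 1 / real (Suc n)} \<and> \<bar>f (x * y) / f x - 1\<bar> > e"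
      by blast
    then have "\<exists>X y. \<forall>n. real n \<le> X n \<and> max a0 1 \<le> X n \<and> y n \<in> {1..1 + 1 / real (Suc n)} \<and>
        \<bar>f (X n * y n) / f (X n) - 1\<bar> > e"
      by (simp only: choice_iff)
    then obtain X y where Xy: "\<And>n. X n \<ge> real n" "\<And>n. X n \<ge> max a0 1" "\<And>n. y n \<in> {1..1 + 1 / real (Suc n)}"
      "\<And>n. \<bar>f (X n * y n) / f (X n) - 1\<bar> > e"
      by blast
    have XX: "X n * y n \<ge> X n" for n
    proof -
      have "X n * 1 \<le> X n * y n" using Xy(2,3)[of n] by (intro mult_left_mono) auto
      then show ?thesis by simp
    qed
    have bad: "\<bar>g (X n * y n) / g (X n) - 1\<bar> > e" for n
    proof -
      have "X n \<ge> a0" "X n * y n \<ge> a0" using Xy(2)[of n] XX[of n] by linarith+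
      then show ?thesis using Xy(4)[of n] by (simp add: g_def)
    qed
    \<comment> \<open>The multipliers that are good from index \<open>n\<close> on. By pointwise
      convergence these sets increase to the whole interval, so their measures tend to
      \<open>b - 1\<close>.\<close>
    define U where "U w n = {z\<in>{1<..<b}. \<forall>m\<ge>n. \<bar>g (w m * z) / g (w m) - 1\<bar> \<le> h}" for w :: "nat \<Rightarrow> real" and n
    have big: "\<forall>\<^sub>F n in sequentially. 3/4 * (b - 1) < measure lebesgue (U w n)"
      if w: "filterlim w at_top sequentially" for w
    proof -
      have Us[measurable]: "U w n \<in> sets borel" for n unfolding U_def by measurable
      have "incseq (U w)" by (auto simp: incseq_def U_def)
      moreover have "(\<Union>n. U w n) = {1<..<b}"
      proof -
        have "\<exists>n. z \<in> U w n" if "z \<in> {1<..<b}" for z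
          using eventually_compose_filterlim[OF blg[OF that] w] that
          by (auto simp: U_def eventually_sequentially)
        then show ?thesis by (auto simp: U_def)
      qed
      moreover have "U w n \<in> fmeasurable lborel" for n
      proof (rule fmeasurableI2[of "{1<..<b}"])
        show "{1<..<b} \<in> fmeasurable lborel" using b by (auto simp: fmeasurable_def)
      qed (auto simp: U_def[of w n] Us[unfolded U_def])
      ultimately have "(\<lambda>n. measure lborel (U w n)) \<longlonglongrightarrow> measure lborel {1<..<b}"
        using Lim_measure_incseq[of "U w" lborel] Us b by (auto simp: fmeasurable_def less_top image_subset_iff)
      moreover have "measure lborel {1<..<b} = b - 1" using b by simp
      ultimately have "\<forall>\<^sub>F n in sequentially. 3/4 * (b - 1) < measure lborel (U w n)"
        using b by (intro order_tendstoD(1)) auto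
      then show ?thesis by simp
    qed
    have X1: "filterlim X at_top sequentially"
      by (rule filterlim_at_top_mono[OF filterlim_real_sequentially]) (use Xy in auto)
    have X2: "filterlim (\<lambda>n. X n * y n) at_top sequentially"
      by (rule filterlim_at_top_mono[OF X1]) (use XX in auto)
    \<comment> \<open>Two sets of measure above \<open>3/4 * (b - 1)\<close> must meet inside an
      interval shorter than \<open>3/2 * (b - 1)\<close>. Both will lie in
      \<open>{1<..<b * y n}\<close>, whose excess length \<open>b * (y n - 1)\<close> is kept below
      \<open>(b - 1) / 2\<close> by this threshold.\<close>
    have "(\<lambda>n. 1 / real (Suc n)) \<longlonglongrightarrow> 0" by real_asymp
    then have "\<forall>\<^sub>F n in sequentially. 1 / real (Suc n) < (b - 1) / (2 * b)"
      using b by (intro order_tendstoD(2)) auto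
    with big[OF X1] big[OF X2]
    have "\<forall>\<^sub>F n in sequentially. False"
    proof eventually_elim
      case (elim n)
      let ?V = "U (\<lambda>n. X n * y n) n" let ?U = "U X n"
      let ?W = "(\<lambda>x. y n *\<^sub>R x + 0) ` ?V"
      have y: "1 \<le> y n" "b * (y n - 1) < (b - 1) / 2"
      proof -
        show "1 \<le> y n" using Xy(3)[of n] by simp
        have "y n - 1 \<le> 1 / real (Suc n)" using Xy(3)[of n] by simp
        then have "y n - 1 < (b - 1) / (2 * b)" using elim(3) by linarith
        then have "b * (y n - 1) < b * ((b - 1) / (2 * b))" using b by (intro mult_strict_left_mono) auto
        then show "b * (y n - 1) < (b - 1) / 2" using b by simp
      qed
      have [measurable]: "?U \<in> sets borel" "?V \<in> sets borel" unfolding U_def by measurable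
      have V0: "?V \<in> sets lebesgue" "?U \<in> sets lebesgue" by auto
      have WV: "measure lebesgue ?W = y n * measure lebesgue ?V"
        using y measure_lebesgue_affine[of "y n" 0 ?V] by simp
      have "?W = {x. x / y n \<in> ?V}"
        using y by (force simp: image_iff intro!: bexI[of _ "_ / y n"])
      also have "\<dots> \<in> sets borel" by measurable
      finally have Ws: "?W \<in> sets lebesgue" by auto
      have disj: "?U \<inter> ?W = {}"
      proof (rule ccontr)
        assume "?U \<inter> ?W \<noteq> {}"
        then obtain z where z: "z \<in> ?V" "y n * z \<in> ?U" by auto
        define r1 where "r1 = g (X n * (y n * z)) / g (X n)"
        define r2 where "r2 = g (X n * y n * z) / g (X n * y n)"
        have r: "\<bar>r1 - 1\<bar> \<le> h" "\<bar>r2 - 1\<bar> \<le> h" using z by (auto simp: U_def r1_def r2_def)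
        have "g (X n * y n) / g (X n) = r1 / r2"
          using gpos[of "X n"] gpos[of "X n * y n"] gpos[of "X n * y n * z"]
          by (auto simp: r1_def r2_def field_simps)
        moreover have "\<bar>r1 / r2 - 1\<bar> \<le> 3 * h"
        proof -
          have "r2 > 0" using r h by auto
          have "\<bar>r1 - r2\<bar> \<le> 2 * h" using r by auto
          also have "2 * h \<le> 3 * h * r2" using r h by (auto simp: abs_le_iff)
          finally show ?thesis using \<open>r2 > 0\<close> by (simp add: field_simps abs_le_iff)
        qed
        ultimately show False using bad[of n] h by auto
      qed
      have sub: "?U \<union> ?W \<subseteq> {1<..<b * y n}"
      proof -
        have "1 < y n * z \<and> y n * z < b * y n" if "1 < z" "z < b" for z
        proof -
          have "z \<le> z * y n" by (rule le_mult_ge_one) (use y that in auto)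
          then have "1 < z * y n" using that by linarith
          moreover have "y n * z < y n * b" using y that by (intro mult_strict_left_mono) auto
          ultimately show ?thesis using that by (auto simp: mult.commute)
        qed
        moreover have "b \<le> b * y n" by (rule le_mult_ge_one) (use y b in auto)
        then have "x < b * y n" if "x < b" for x using that by linarith
        ultimately show ?thesis by (auto simp: U_def)
      qed
      have fm: "?U \<in> lmeasurable" "?W \<in> lmeasurable"
        using sub V0 Ws by (auto intro!: bounded_set_imp_lmeasurable bounded_subset[OF bounded_box[of 1 "b * y n"]] simp: box_real)
      have "measure lebesgue ?U + measure lebesgue ?W = measure lebesgue (?U \<union> ?W)"
        using fm disj by (simp add: measure_Un3)
      also have "\<dots> \<le> measure lebesgue {1<..<b * y n}"
        using sub fm by (intro measure_mono_fmeasurable) auto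
      also have "\<dots> = b * y n - 1"
      proof -
        have "b \<le> b * y n" by (rule le_mult_ge_one) (use y b in auto)
        then have "1 \<le> b * y n" using b by linarith
        then show ?thesis by (subst measure_completion) auto
      qed
      finally have "measure lebesgue ?U + y n * measure lebesgue ?V \<le> b * y n - 1" using WV by simp
      moreover have "1 * measure lebesgue ?V \<le> y n * measure lebesgue ?V"
        using y by (intro mult_right_mono) auto
      ultimately show False using elim y b by (auto simp: algebra_simps)
    qed
    then show False by simp
  qed
qed

text \<open>For \<open>z \<le> 0\<close> the shift is a multiplication by
  \<open>1 - z / x \<ge> 1\<close>. For \<open>z > 0\<close> it is \<open>x\<close> that is a
  multiple of \<open>x - z\<close>, and the ratio has to be inverted, which costs the factor 2 in
  \<open>h\<close>. Since \<open>x - z \<ge> x / 2\<close>, the choice \<open>d \<le> d0 / 2\<close>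
  keeps the multiplier below \<open>1 + d0\<close>.\<close>

lemma irv_shift:
  assumes irv: "intermediate_regularly_varying f" and e: "e > 0"
  shows "\<exists>d>0. d < 1 \<and> (\<forall>\<^sub>F x in at_top. \<forall>z. \<bar>z\<bar> \<le> d * x \<longrightarrow> \<bar>f (x - z) / f x - 1\<bar> \<le> e)"
proof -
  from irv obtain a0 where a0: "\<And>x. x \<ge> a0 \<Longrightarrow> 0 < f x"
    unfolding intermediate_regularly_varying_def pos_measurable_near_infinity_def by blast
  define h where "h = min (1/2) (e / 2)"
  have h: "0 < h" "h \<le> 1/2" "2 * h \<le> e" using e by (auto simp: h_def)
  obtain d0 where d0: "d0 > 0" "\<forall>\<^sub>F x in at_top. \<forall>y\<in>{1..1+d0}. \<bar>f (x * y) / f x - 1\<bar> \<le> h"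
    using irv_uniform[OF irv h(1)] by blast
  then obtain X0 where X0: "\<And>x y. x \<ge> X0 \<Longrightarrow> y \<in> {1..1+d0} \<Longrightarrow> \<bar>f (x * y) / f x - 1\<bar> \<le> h"
    unfolding eventually_at_top_linorder by blast
  define X where "X = max X0 (max a0 1)"
  define d where "d = min (1/2) (d0 / 2)"
  have d: "d > 0" "d \<le> 1/2" "2 * d \<le> d0" using d0 by (auto simp: d_def)
  have "\<bar>f (x - z) / f x - 1\<bar> \<le> e" if x: "x \<ge> 2 * X" and z: "\<bar>z\<bar> \<le> d * x" for x z
  proof -
    have X1: "X \<ge> 1" by (simp add: X_def)
    have dx: "d * x \<le> 1/2 * x" using d x X1 by (intro mult_right_mono) auto
    show ?thesis
    proof (cases "z \<le> 0")
      case True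
      have "d * x \<le> d0 * x" using d x X1 by (intro mult_right_mono) auto
      then have "- z \<le> d0 * x" using z by linarith
      then have "1 - z / x \<in> {1..1+d0}" using True x X1 by (auto simp: field_simps)
      moreover have "x * (1 - z / x) = x - z" "x \<ge> X0" using x X1 by (auto simp: X_def field_simps)
      ultimately show ?thesis using X0[of x "1 - z / x"] h by auto
    next
      case False
      have xz: "x - z \<ge> X" "x - z \<ge> a0" "x - z > 0" "x > 0" "x \<ge> a0"
      proof -
        have "X0 \<le> X" "a0 \<le> X" by (auto simp: X_def)
        then show "x - z \<ge> X" "x - z \<ge> a0" "x - z > 0" "x > 0" "x \<ge> a0" using z dx x X1 by linarith+
      qed
      have "d * (x / 2) \<le> d * (x - z)" using z dx d by (intro mult_left_mono) auto
      then have "z \<le> 2 * d * (x - z)" using z by linarith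
      moreover have "2 * d * (x - z) \<le> d0 * (x - z)" using d xz by (intro mult_right_mono) auto
      ultimately have "z \<le> d0 * (x - z)" by linarith
      then have "x / (x - z) \<in> {1..1+d0}" using False xz by (auto simp: field_simps)
      from X0[OF _ this, of "x - z"] xz have *: "\<bar>f x / f (x - z) - 1\<bar> \<le> h"
        by (auto simp: X_def)
      define r where "r = f x / f (x - z)"
      have r: "\<bar>r - 1\<bar> \<le> h" "r > 0" using * a0 xz by (auto simp: r_def)
      have "h \<le> 2 * h * r" using r h by (auto simp: abs_le_iff)
      with r have "\<bar>1 / r - 1\<bar> \<le> 2 * h" by (simp add: field_simps abs_le_iff)
      moreover have "1 / r = f (x - z) / f x" by (simp add: r_def)
      ultimately show ?thesis using h by auto
    qed
  qed
  then have "\<forall>\<^sub>F x in at_top. \<forall>z. \<bar>z\<bar> \<le> d * x \<longrightarrow> \<bar>f (x - z) / f x - 1\<bar> \<le> e"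
    by (auto simp: eventually_at_top_linorder)
  then show ?thesis using d by (intro exI[of _ d]) auto
qed

section \<open>Exponential tilting\<close>

text \<open>It holds for all negative \<open>s\<close>, so the left tail of a step needs no
  truncation, and the coefficient \<open>exp h / 2\<close> tends to \<open>1 / 2\<close> with
  \<open>h\<close>, which is what keeps the Gaussian exponent sharp.\<close>

lemma exp_le_quadratic:
  fixes s h :: real
  assumes "s \<le> h" "0 \<le> h"
  shows "exp s \<le> 1 + s + exp h * s\<^sup>2 / 2"
proof (cases "s \<le> 0")
  case True
  let ?g = "\<lambda>s::real. 1 + s + s\<^sup>2 / 2 - exp s"
  have "?g 0 \<le> ?g s"
  proof (rule DERIV_nonpos_imp_nonincreasing[OF True])
    fix x :: real
    have "(?g has_real_derivative 1 + x - exp x) (at x)"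
      by (auto intro!: derivative_eq_intros)
    then show "\<exists>y. (?g has_real_derivative y) (at x) \<and> y \<le> 0"
      using exp_ge_add_one_self[of x] by (intro exI[of _ "1 + x - exp x"]) auto
  qed
  moreover have "1 * s\<^sup>2 / 2 \<le> exp h * s\<^sup>2 / 2"
    using assms by (intro divide_right_mono mult_right_mono) auto
  ultimately show ?thesis by simp
next
  case False
  obtain t where t: "\<bar>t\<bar> \<le> \<bar>s\<bar>" "exp s = (\<Sum>m<2. s ^ m / fact m) + exp t / fact 2 * s ^ 2"
    using Maclaurin_exp_le by blast
  have "exp t / fact 2 * s ^ 2 \<le> exp h / 2 * s ^ 2"
    using t False assms by (intro mult_mono divide_mono) auto
  with t show ?thesis by (simp add: numeral_2_eq_2)
qed

lemma cos_ge_half: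
  fixes s :: real
  assumes "\<bar>s\<bar> \<le> 1"
  shows "1 / 2 \<le> cos s"
proof -
  have "cos (pi / 3) \<le> cos \<bar>s\<bar>"
    using assms pi_gt3 by (intro cos_monotone_0_pi_le) auto
  then show ?thesis by (simp add: cos_60)
qed

lemma one_minus_cos_ge:
  fixes s :: real
  assumes "\<bar>s\<bar> \<le> 1"
  shows "s\<^sup>2 / 4 \<le> 1 - cos s"
proof -
  obtain t where t: "\<bar>t\<bar> \<le> \<bar>s\<bar>" "cos s = (\<Sum>m<2. cos_coeff m * s ^ m) + (cos (t + 1 / 2 * real 2 * pi) / fact 2) * s ^ 2"
    using Maclaurin_cos_expansion by blast
  have "cos s = 1 - cos t / 2 * s\<^sup>2"
    using t(2) by (simp add: numeral_2_eq_2 cos_coeff_def)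
  moreover have "1 / 2 / 2 * s\<^sup>2 \<le> cos t / 2 * s\<^sup>2"
    using cos_ge_half[of t] t assms by (intro mult_right_mono divide_right_mono) auto
  ultimately show ?thesis by simp
qed

lemma sum_power_inj_le:
  fixes q :: real
  assumes "finite A" "inj_on h A" "0 \<le> q" "q < 1"
  shows "(\<Sum>k\<in>A. q ^ h k) \<le> 1 / (1 - q)"
proof -
  have "(\<Sum>k\<in>A. q ^ h k) = (\<Sum>m\<in>h ` A. q ^ m)"
    using assms by (simp add: sum.reindex)
  also have "\<dots> \<le> (\<Sum>m. q ^ m)"
    using assms by (intro sum_le_suminf summable_geometric) auto
  also have "\<dots> = 1 / (1 - q)"
    using assms by (intro suminf_geometric) auto
  finally show ?thesis .
qed

text \<open>The bound is free of \<open>N\<close>, so summing over all pairs of indices below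
  \<open>N\<close> costs a factor of order \<open>N\<close> instead of
  \<open>N\<^sup>2\<close>.\<close>

lemma sum_power_dist_le:
  fixes q :: real
  assumes "0 \<le> q" "q < 1"
  shows "(\<Sum>k<N. q ^ nat \<bar>int j - int k\<bar>) \<le> 2 / (1 - q)"
proof -
  have "(\<Sum>k<N. q ^ nat \<bar>int j - int k\<bar>) =
      (\<Sum>k\<in>{k\<in>{..<N}. k \<le> j}. q ^ nat \<bar>int j - int k\<bar>) + (\<Sum>k\<in>{k\<in>{..<N}. \<not> k \<le> j}. q ^ nat \<bar>int j - int k\<bar>)"
    by (subst sum.union_disjoint[symmetric]) (auto intro!: sum.cong)
  also have "\<dots> \<le> 1 / (1 - q) + 1 / (1 - q)"
    using assms by (intro add_mono sum_power_inj_le) (auto simp: inj_on_def)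
  finally show ?thesis by simp
qed

lemma shifted_Delta: "y \<in> (+) x ` Delta T \<longleftrightarrow> x < y \<and> ereal (y - x) \<le> T"
proof
  assume "x < y \<and> ereal (y - x) \<le> T"
  then show "y \<in> (+) x ` Delta T"
    by (intro image_eqI[of _ _ "y - x"]) (auto simp: Delta_def)
qed (auto simp: Delta_def)

lemma shifted_Delta_borel [measurable]: "(+) x ` Delta T \<in> sets borel"
proof -
  have "(+) x ` Delta T = {y. x < y \<and> ereal (y - x) \<le> T}"
    by (intro set_eqI) (simp only: shifted_Delta mem_Collect_eq)
  also have "\<dots> \<in> sets borel" by measurable
  finally show ?thesis .
qed

lemma shifted_Delta_add: "y + s \<in> (+) x ` Delta T \<longleftrightarrow> y \<in> (+) (x - s) ` Delta T"
  unfolding shifted_Delta by (auto simp: algebra_simps)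

section \<open>The tilted law of a single step\<close>

locale real_distribution_second_moment = prob_space F for F :: "real measure" +
  assumes sets_F [measurable_cong, simp]: "sets F = sets borel"
    and int_id: "integrable F (\<lambda>u. u)" and mean_zero: "(\<integral>u. u \<partial>F) = 0"
    and int_sq: "integrable F (\<lambda>u. u\<^sup>2)" and second_moment: "(\<integral>u. u\<^sup>2 \<partial>F) = 1"
begin

lemma space_F [simp]: "space F = UNIV"
  using sets_eq_imp_space_eq[OF sets_F] by simp

lemma integrable_indicator_F [simp]: "S \<in> sets borel \<Longrightarrow> integrable F (indicator S :: real \<Rightarrow> real)"
  by (intro integrable_real_indicator) (auto simp: less_top[symmetric])

text \<open>The density of an exponential change of measure, cut off at \<open>y\<close> and left
  unnormalised. The cut makes it bounded for \<open>l \<ge> 0\<close>, and a product of such weights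
  vanishes as soon as one step exceeds \<open>y\<close>.\<close>

definition tilt :: "real \<Rightarrow> real \<Rightarrow> real \<Rightarrow> real" where
  "tilt l y u = exp (l * u) * indicator {..y} u"

lemma tilt_measurable [measurable]: "tilt l y \<in> borel_measurable borel"
  unfolding tilt_def by measurable

lemma tilt_nonneg [simp]: "0 \<le> tilt l y u"
  by (simp add: tilt_def)

lemma tilt_le: "0 \<le> l \<Longrightarrow> tilt l y u \<le> exp (l * y)"
  by (auto simp: tilt_def indicator_def mult_left_mono)

lemma integrable_tilt_mult:
  fixes g :: "real \<Rightarrow> 'b::{banach, second_countable_topology, real_normed_algebra_1}"
  assumes "0 \<le> l" and [measurable]: "g \<in> borel_measurable borel" and "\<And>u. norm (g u) \<le> 1"
  shows "integrable F (\<lambda>u. of_real (tilt l y u) * g u)"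
proof (rule integrable_const_bound[where B = "exp (l * y)"])
  show "AE u in F. norm (of_real (tilt l y u) * g u) \<le> exp (l * y)"
  proof (rule AE_I2)
    fix u
    have "norm (of_real (tilt l y u) * g u) \<le> norm (of_real (tilt l y u) :: 'b) * norm (g u)"
      by (rule norm_mult_ineq)
    also have "\<dots> \<le> exp (l * y) * 1"
      using tilt_le[of l y u] assms by (intro mult_mono) auto
    finally show "norm (of_real (tilt l y u) * g u) \<le> exp (l * y)" by simp
  qed
qed measurable

lemma integrable_tilt: "0 \<le> l \<Longrightarrow> integrable F (tilt l y)"
  using integrable_tilt_mult[of l "\<lambda>_. 1 :: real" y] by simp

text \<open>Below \<open>v\<close> the integrand obeys a quadratic bound, whose linear term drops out because the mean
  vanishes.\<close>

lemma integral_tilt_le: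
  assumes "0 < l" "0 \<le> h" "0 < v" "l * v \<le> h" "0 < y"
  shows "(\<integral>u. tilt l y u \<partial>F) \<le> 1 + exp h * l\<^sup>2 / 2 + exp (l * y) * measure F {v<..y}"
proof -
  have "tilt l y u \<le> 1 + l * u + exp h * l\<^sup>2 / 2 * u\<^sup>2 + exp (l * y) * indicator {v<..y} u" for u
  proof (cases "u \<le> v")
    case True
    then have "l * u \<le> h" using mult_left_mono[of u v l] assms by linarith
    then have "exp (l * u) \<le> 1 + l * u + exp h * (l * u)\<^sup>2 / 2"
      using assms by (intro exp_le_quadratic) auto
    moreover have "tilt l y u \<le> exp (l * u)" by (simp add: tilt_def indicator_def)
    ultimately show ?thesis using True by (simp add: power_mult_distrib mult_ac)
  next
    case False
    then have u: "u > 0" "u > v" using assms by auto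
    have "0 \<le> 1 + l * u + exp h * l\<^sup>2 / 2 * u\<^sup>2" using u assms by simp
    moreover have "tilt l y u \<le> exp (l * y) * indicator {v<..y} u"
      using u assms by (auto simp: tilt_def indicator_def)
    ultimately show ?thesis by linarith
  qed
  then have "(\<integral>u. tilt l y u \<partial>F) \<le>
      (\<integral>u. 1 + l * u + exp h * l\<^sup>2 / 2 * u\<^sup>2 + exp (l * y) * indicator {v<..y} u \<partial>F)"
    using assms int_id int_sq by (intro integral_mono) (auto intro!: integrable_tilt)
  also have "\<dots> = 1 + exp h * l\<^sup>2 / 2 + exp (l * y) * measure F {v<..y}"
    using int_id int_sq mean_zero second_moment prob_space by simp
  finally show ?thesis .
qed

text \<open>If \<open>F\<close> were carried by the positive half-line, the vanishing mean of a
  nonnegative function would force \<open>u = 0\<close> almost everywhere.\<close>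

lemma pos_mass_nonpos: "0 < measure F {..0}"
proof (rule ccontr)
  assume "\<not> 0 < measure F {..0}"
  then have "measure F {..0} = 0" by (simp add: not_less measure_le_0_iff)
  then have ae: "AE u in F. u > 0"
    by (intro AE_I[where N = "{..0}"]) (auto simp: emeasure_eq_measure)
  then have "AE u in F. 0 \<le> u" by eventually_elim simp
  then have "AE u in F. u = 0"
    using integral_nonneg_eq_0_iff_AE[OF int_id] mean_zero by simp
  with ae have "AE u in F. False" by eventually_elim auto
  then show False by simp
qed

text \<open>Two bounded blocks of positive mass at distance at least 1 are what pushes the modulus
  of the characteristic function below the total mass. Being bounded, they keep their weight under
  the tilt for all \<open>l\<close> between 0 and 1 and for every cut
  \<open>y \<ge> R\<close>.\<close>

lemma exists_spread:
  assumes "0 < measure F {1..}"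
  shows "\<exists>R\<ge>1. 0 < measure F {-R..0} \<and> 0 < measure F {1..R}"
proof -
  have "(\<lambda>n. measure F {-real n..0}) \<longlonglongrightarrow> measure F (\<Union>n. {-real n..0})"
    by (rule finite_Lim_measure_incseq) (auto simp: incseq_def)
  moreover have "(\<Union>n. {-real n..0}) = {..0}"
  proof -
    have "\<exists>n. - real n \<le> x" for x 
    proof -
      obtain n where "- x \<le> real n" using real_arch_simple by blast
      then show ?thesis by (intro exI[of _ n]) linarith
    qed
    then show ?thesis by (auto simp: set_eq_iff)
  qed
  ultimately have 1: "\<forall>\<^sub>F n in sequentially. 0 < measure F {-real n..0}"
    using pos_mass_nonpos order_tendstoD(1) by metis
  have "(\<lambda>n. measure F {1..real n}) \<longlonglongrightarrow> measure F (\<Union>n. {1..real n})"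
    by (rule finite_Lim_measure_incseq) (auto simp: incseq_def)
  moreover have "(\<Union>n. {1..real n}) = {1..}" by (auto simp: real_arch_simple)
  ultimately have 2: "\<forall>\<^sub>F n in sequentially. 0 < measure F {1..real n}"
    using assms order_tendstoD(1) by metis
  from 1 2 eventually_ge_at_top[of 1]
  have "\<forall>\<^sub>F n in sequentially. 1 \<le> n \<and> 0 < measure F {-real n..0} \<and> 0 < measure F {1..real n}"
    by eventually_elim auto
  then obtain n :: nat where "1 \<le> n" "0 < measure F {-real n..0}" "0 < measure F {1..real n}"
    using eventually_happens'[OF sequentially_bot] by blast
  then show ?thesis by (intro exI[of _ "real n"]) auto
qed

definition tilt_char :: "real \<Rightarrow> real \<Rightarrow> real \<Rightarrow> complex" where
  "tilt_char l y \<theta> = (\<integral>u. of_real (tilt l y u) * cis (\<theta> * u) \<partial>F)"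

text \<open>The difference of the squares is the integral of \<open>1 - cos (\<theta> (u - v))\<close> with respect to
  two copies of the tilted measure; it is bounded below by the contribution of \<open>u \<le> 0\<close> and
  \<open>v \<ge> 1\<close>.\<close>

lemma tilt_char_le:
  assumes R: "R \<ge> 1" and l: "0 \<le> l" "l \<le> 1" and y: "R \<le> y" and \<theta>: "\<bar>\<theta>\<bar> * (2 * R) \<le> 1"
  shows "(cmod (tilt_char l y \<theta>))\<^sup>2 \<le>
    (\<integral>u. tilt l y u \<partial>F)\<^sup>2 - exp (- R) * measure F {-R..0} * measure F {1..R} / 4 * \<theta>\<^sup>2"
proof -
  define w where "w = tilt l y"
  have [measurable]: "w \<in> borel_measurable borel" by (simp add: w_def)
  have w0: "0 \<le> w u" for u by (simp add: w_def)
  define A where "A = (\<integral>u. w u \<partial>F)"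
  define C where "C = (\<integral>u. w u * cos (\<theta> * u) \<partial>F)"
  define S where "S = (\<integral>u. w u * sin (\<theta> * u) \<partial>F)"
  have int: "integrable F (\<lambda>u. w u * g u)"
    if "g \<in> borel_measurable borel" "\<And>u. \<bar>g u\<bar> \<le> 1" for g :: "real \<Rightarrow> real"
    using integrable_tilt_mult[of l g y] that l by (simp add: w_def)
  have intw: "integrable F w" using integrable_tilt l by (simp add: w_def)
  have intc: "integrable F (\<lambda>u. w u * cos (c * u))" "integrable F (\<lambda>u. w u * sin (c * u))" for c
    by (auto intro!: int)
  have ic: "integrable F (\<lambda>u. of_real (tilt l y u) * cis (\<theta> * u))"
    using l by (intro integrable_tilt_mult) (auto simp: cis_conv_exp)
  have "Re (tilt_char l y \<theta>) = C" "Im (tilt_char l y \<theta>) = S"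
    unfolding tilt_char_def C_def S_def w_def using ic
    by (simp_all flip: integral_Re integral_Im)
  then have cm: "(cmod (tilt_char l y \<theta>))\<^sup>2 = C\<^sup>2 + S\<^sup>2" by (simp add: cmod_power2)
  \<comment> \<open>The inner integral over the second copy \<open>v\<close>, expanded by the
    addition formula. In this form iterated single integrals replace the product measure.\<close>
  define k where "k u = A - C * cos (\<theta> * u) - S * sin (\<theta> * u)" for u
  have k_eq: "k u = (\<integral>v. w v * (1 - cos (\<theta> * (u - v))) \<partial>F)" for u
  proof -
    have "(\<integral>v. w v * (1 - cos (\<theta> * (u - v))) \<partial>F) =
      (\<integral>v. w v - cos (\<theta> * u) * (w v * cos (\<theta> * v)) - sin (\<theta> * u) * (w v * sin (\<theta> * v)) \<partial>F)"
      by (intro Bochner_Integration.integral_cong) (auto simp: cos_diff algebra_simps)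
    also have "\<dots> = A - cos (\<theta> * u) * C - sin (\<theta> * u) * S"
      using intw intc[of \<theta>] by (simp add: A_def C_def S_def)
    also have "\<dots> = k u" by (simp add: k_def)
    finally show ?thesis by simp
  qed
  have intk: "integrable F (\<lambda>v. w v * (1 - cos (\<theta> * (u - v))))" for u
  proof -
    have "integrable F (\<lambda>v. w v - w v * cos (\<theta> * (u - v)))"
      using intw by (intro Bochner_Integration.integrable_diff int) auto
    then show ?thesis by (simp add: right_diff_distrib)
  qed
  have k0: "0 \<le> k u" for u
    unfolding k_eq by (intro integral_nonneg_AE AE_I2 mult_nonneg_nonneg) (auto simp: w0)
  define PI where "PI = measure F {-R..0}"
  define PJ where "PJ = measure F {1..R}"
  have kI: "PJ * (\<theta>\<^sup>2 / 4) \<le> k u" if u: "u \<in> {-R..0}" for u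
  proof -
    have "indicator {1..R} v * (\<theta>\<^sup>2 / 4) \<le> w v * (1 - cos (\<theta> * (u - v)))" for v
    proof (cases "v \<in> {1..R}")
      case True
      have "1 \<le> w v" using True y l by (simp add: w_def tilt_def)
      moreover have "\<theta>\<^sup>2 / 4 \<le> 1 - cos (\<theta> * (u - v))"
      proof -
        have "\<bar>\<theta>\<bar> * \<bar>u - v\<bar> \<le> \<bar>\<theta>\<bar> * (2 * R)"
          using True u by (intro mult_left_mono) auto
        then have "(\<theta> * (u - v))\<^sup>2 / 4 \<le> 1 - cos (\<theta> * (u - v))"
          using \<theta> by (intro one_minus_cos_ge) (auto simp: abs_mult)
        moreover have "1\<^sup>2 \<le> (v - u)\<^sup>2" using True u by (intro power_mono) auto
        then have "\<theta>\<^sup>2 * 1 \<le> \<theta>\<^sup>2 * (u - v)\<^sup>2"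
          by (intro mult_left_mono) (auto simp: power2_commute)
        ultimately show ?thesis by (simp add: power_mult_distrib)
      qed
      ultimately have "1 * (\<theta>\<^sup>2 / 4) \<le> w v * (1 - cos (\<theta> * (u - v)))"
        by (intro mult_mono) auto
      then show ?thesis using True by simp
    qed (auto simp: w0)
    then have "(\<integral>v. indicator {1..R} v * (\<theta>\<^sup>2 / 4) \<partial>F) \<le> (\<integral>v. w v * (1 - cos (\<theta> * (u - v))) \<partial>F)"
      using intk by (intro integral_mono integrable_mult_left) auto
    then show ?thesis by (simp add: k_eq PJ_def)
  qed
  have "indicator {-R..0} u * (exp (-R) * (PJ * (\<theta>\<^sup>2 / 4))) \<le> w u * k u" for u
  proof (cases "u \<in> {-R..0}")
    case True
    have "- R \<le> l * u"
    proof -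
      have "1 * u \<le> l * u" using True l by (intro mult_right_mono_neg) auto
      then show ?thesis using True by simp
    qed
    then have "exp (-R) \<le> w u" using True y R by (simp add: w_def tilt_def)
    then have "exp (-R) * (PJ * (\<theta>\<^sup>2 / 4)) \<le> w u * k u"
      using kI[OF True] w0 by (intro mult_mono) (auto simp: PJ_def)
    then show ?thesis using True by simp
  qed (auto simp: w0 k0)
  moreover have wk: "w u * k u = A * w u - C * (w u * cos (\<theta> * u)) - S * (w u * sin (\<theta> * u))" for u
    by (simp add: k_def algebra_simps)
  ultimately have "(\<integral>u. indicator {-R..0} u * (exp (-R) * (PJ * (\<theta>\<^sup>2 / 4))) \<partial>F) \<le>
      (\<integral>u. A * w u - C * (w u * cos (\<theta> * u)) - S * (w u * sin (\<theta> * u)) \<partial>F)"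
    using intw intc by (intro integral_mono integrable_mult_left) auto
  also have "\<dots> = A\<^sup>2 - C\<^sup>2 - S\<^sup>2"
    using intw intc[of \<theta>] by (simp add: A_def[symmetric] C_def[symmetric] S_def[symmetric] power2_eq_square)
  finally show ?thesis
    by (simp add: cm A_def w_def PJ_def mult_ac)
qed

text \<open>For \<open>T = \<infinity>\<close> both \<open>real_of_ereal T\<close> and \<open>1 / real_of_ereal T\<close> are \<open>0\<close>, which is the right
  value here and in the next lemma.\<close>

lemma window_cut_le:
  assumes T: "0 < T" and le: "\<And>v. u - real_of_ereal T \<le> v \<Longrightarrow> window F T v \<le> c" and c: "0 \<le> c"
  shows "measure F ((+) v ` Delta T \<inter> {u<..}) \<le> c"
proof (cases T)
  case (real r)
  show ?thesis
  proof (cases "u - r \<le> v")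
    case True
    have "measure F ((+) v ` Delta T \<inter> {u<..}) \<le> window F T v"
      unfolding window_def by (intro finite_measure_mono) auto
    also have "\<dots> \<le> c" using True real by (intro le) auto
    finally show ?thesis .
  next
    case False
    then have "(+) v ` Delta T \<inter> {u<..} = {}"
      using real by (auto simp: Delta_def)
    then show ?thesis using c by simp
  qed
next
  case PInf
  have "measure F ((+) v ` Delta T \<inter> {u<..}) \<le> window F T (max v u)"
    unfolding window_def
  proof (intro finite_measure_mono subsetI)
    fix y assume "y \<in> (+) v ` Delta T \<inter> {u<..}"
    then show "y \<in> (+) (max v u) ` Delta T" unfolding Int_iff shifted_Delta using PInf by auto
  qed auto
  also have "\<dots> \<le> c" using PInf by (intro le) auto
  finally show ?thesis .
qed (use T in auto)

text \<open>For finite \<open>T\<close> the interval is covered by consecutive windows, at most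
  \<open>(1 / r + 1) * x\<close> of them as \<open>x \<ge> 1\<close>, each of mass at most the power
  bound at \<open>v\<close>. The resulting factor \<open>x powr 1\<close> is the whole difference
  from \<open>T = \<infinity>\<close>, where one window suffices.\<close>

lemma interval_le_windows:
  assumes T: "0 < T" and X0: "1 \<le> X0" and \<alpha>: "\<alpha> \<le> 0" and K: "0 \<le> K"
    and up: "\<And>w. X0 \<le> w \<Longrightarrow> window F T w \<le> K * w powr \<alpha>"
    and q: "q = (if T = \<infinity> then 0 else 1)"
    and v: "X0 \<le> v" and x: "1 \<le> x" "y \<le> x"
  shows "measure F {v<..y} \<le> K * (1 / real_of_ereal T + 1) * x powr q * v powr \<alpha>"
proof (cases T)
  case (real r)
  then have r: "r > 0" using T by simp
  define m where "m = nat \<lceil>x / r\<rceil>"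
  have "measure F {v<..y} \<le> measure F (\<Union>k<m. (+) (v + real k * r) ` Delta T)"
  proof (intro finite_measure_mono subsetI)
    fix z assume z: "z \<in> {v<..y}"
    define j where "j = \<lceil>(z - v) / r\<rceil>"
    have j1: "j \<ge> 1" using z r by (simp add: j_def)
    have "(z - v) / r \<le> x / r" using z x v X0 r by (intro divide_right_mono) auto
    then have jm: "j \<le> \<lceil>x / r\<rceil>" unfolding j_def by (rule ceiling_mono)
    have "of_int j - 1 < (z - v) / r" "(z - v) / r \<le> of_int j" unfolding j_def by linarith+
    then have "(of_int j - 1) * r < z - v" "z - v \<le> of_int j * r" using r by (auto simp: field_simps)
    then have "z \<in> (+) (v + real (nat (j - 1)) * r) ` Delta T"
      unfolding shifted_Delta using j1 real by (auto simp: algebra_simps)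
    moreover have "nat (j - 1) < m" unfolding m_def using j1 jm by linarith
    ultimately show "z \<in> (\<Union>k<m. (+) (v + real k * r) ` Delta T)" by blast
  qed auto
  also have "\<dots> \<le> (\<Sum>k<m. window F T (v + real k * r))"
    unfolding window_def by (intro measure_UNION_le) auto
  also have "\<dots> \<le> (\<Sum>k<m. K * v powr \<alpha>)"
  proof (intro sum_mono)
    fix k
    have "v \<le> v + real k * r" using r by simp
    then have "window F T (v + real k * r) \<le> K * (v + real k * r) powr \<alpha>"
      using v by (intro up) auto
    also have "\<dots> \<le> K * v powr \<alpha>"
      using \<open>v \<le> v + real k * r\<close> v X0 \<alpha> K by (intro mult_left_mono powr_mono2') auto
    finally show "window F T (v + real k * r) \<le> K * v powr \<alpha>" .
  qed
  also have "\<dots> = real m * (K * v powr \<alpha>)" by simp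
  also have "\<dots> \<le> ((1 / r + 1) * x) * (K * v powr \<alpha>)"
  proof (intro mult_right_mono)
    have "0 \<le> x / r" using x r by simp
    then have "real m \<le> x / r + 1" unfolding m_def by linarith
    also have "\<dots> \<le> (1 / r + 1) * x" using x by (simp add: algebra_simps)
    finally show "real m \<le> (1 / r + 1) * x" .
  qed (use K in auto)
  finally show ?thesis using real x q by (simp add: mult_ac)
next
  case PInf
  have "measure F {v<..y} \<le> window F T v"
    unfolding window_def
    by (intro finite_measure_mono subsetI) (auto simp only: shifted_Delta PInf, auto)
  also have "\<dots> \<le> K * v powr \<alpha>" using v by (rule up)
  finally show ?thesis using PInf q x by simp
qed (use T in auto)

end

section \<open>Sums of independent steps\<close>

locale iid_walk = prob_space M + F: real_distribution_second_moment F
  for M :: "'a measure" and F :: "real measure" +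
  fixes \<xi> :: "nat \<Rightarrow> 'a \<Rightarrow> real"
  assumes indep: "indep_vars (\<lambda>_. borel) \<xi> UNIV" and distr_eq: "\<And>i. distr M borel (\<xi> i) = F"
begin

section \<open>Moments and tails of partial sums\<close>

lemma rv [measurable]: "\<xi> i \<in> borel_measurable M"
  using indep by (auto simp: indep_vars_def)

lemma integral_step:
  fixes g :: "real \<Rightarrow> 'b::{banach, second_countable_topology}"
  assumes "g \<in> borel_measurable borel"
  shows "(\<integral>\<omega>. g (\<xi> i \<omega>) \<partial>M) = (\<integral>u. g u \<partial>F)"
  using integral_distr[OF rv assms, of i] by (simp add: distr_eq)

lemma integrable_step:
  fixes g :: "real \<Rightarrow> 'b::{banach, second_countable_topology}"
  assumes "g \<in> borel_measurable borel" "integrable F g"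
  shows "integrable M (\<lambda>\<omega>. g (\<xi> i \<omega>))"
  using integrable_distr_eq[OF rv assms(1), of i] assms(2) by (simp add: distr_eq)

lemma sum_moments:
  assumes "finite I"
  shows "integrable M (\<lambda>\<omega>. \<Sum>j\<in>I. \<xi> j \<omega>) \<and> (\<integral>\<omega>. (\<Sum>j\<in>I. \<xi> j \<omega>) \<partial>M) = 0 \<and>
    integrable M (\<lambda>\<omega>. (\<Sum>j\<in>I. \<xi> j \<omega>)\<^sup>2) \<and> (\<integral>\<omega>. (\<Sum>j\<in>I. \<xi> j \<omega>)\<^sup>2 \<partial>M) = card I"
  using assms
proof (induction I rule: finite_induct)
  case (insert i I)
  let ?s = "\<lambda>\<omega>. \<Sum>j\<in>I. \<xi> j \<omega>"
  have m1: "integrable M (\<xi> i)" by (rule integrable_step[OF _ F.int_id]) simp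
  have m2: "(\<integral>\<omega>. \<xi> i \<omega> \<partial>M) = 0" using integral_step[of "\<lambda>u. u" i] F.mean_zero by simp
  have m3: "integrable M (\<lambda>\<omega>. (\<xi> i \<omega>)\<^sup>2)" by (rule integrable_step[OF _ F.int_sq]) simp
  have m4: "(\<integral>\<omega>. (\<xi> i \<omega>)\<^sup>2 \<partial>M) = 1" using integral_step[of "\<lambda>u. u\<^sup>2" i] F.second_moment by simp
  note m = m1 m2 m3 m4
  have ind: "indep_var borel (\<xi> i) borel ?s"
    using insert by (intro indep_vars_sum indep_vars_subset[OF indep]) auto
  have cross: "integrable M (\<lambda>\<omega>. \<xi> i \<omega> * ?s \<omega>)" "(\<integral>\<omega>. \<xi> i \<omega> * ?s \<omega> \<partial>M) = 0"
    using indep_var_integrable[OF ind] indep_var_lebesgue_integral[OF ind] m insert.IH by auto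
  have sq: "(\<xi> i \<omega> + ?s \<omega>)\<^sup>2 = (\<xi> i \<omega>)\<^sup>2 + 2 * (\<xi> i \<omega> * ?s \<omega>) + (?s \<omega>)\<^sup>2" for \<omega>
    by (simp add: power2_sum)
  show ?case
    using insert m cross unfolding sum.insert[OF insert(1,2)] sq by simp
qed simp

lemma sum_tail:
  assumes "finite I" "r > 0"
  shows "prob {\<omega>\<in>space M. r \<le> \<bar>\<Sum>j\<in>I. \<xi> j \<omega>\<bar>} \<le> card I / r\<^sup>2"
  using Chebyshev_inequality[of "\<lambda>\<omega>. \<Sum>j\<in>I. \<xi> j \<omega>" r] sum_moments[OF assms(1)] assms
  by simp

lemma tail_le: "u > 0 \<Longrightarrow> measure F {u<..} \<le> 1 / u\<^sup>2"
proof -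
  assume u: "u > 0"
  have "measure F {u<..} = prob {\<omega>\<in>space M. \<xi> 0 \<omega> \<in> {u<..}}"
    using measure_distr[OF rv[of 0], of "{u<..}"] by (simp add: distr_eq vimage_def Int_def conj_commute)
  also have "\<dots> \<le> prob {\<omega>\<in>space M. u \<le> \<bar>\<Sum>j\<in>{0}. \<xi> j \<omega>\<bar>}"
    by (intro finite_measure_mono) auto
  also have "\<dots> \<le> 1 / u\<^sup>2" using sum_tail[of "{0}" u] u by simp
  finally show ?thesis .
qed

section \<open>Conditioning on all steps but one\<close>

abbreviation rest :: "nat set \<Rightarrow> 'a \<Rightarrow> nat \<Rightarrow> real" where
  "rest I \<equiv> (\<lambda>\<omega>. \<lambda>j\<in>I. \<xi> j \<omega>)"

text \<open>Fubini's theorem for the joint law of one step and the others. The step is carried as a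
  restriction to \<open>{i}\<close>, because independence is available for restrictions of the
  family to disjoint index sets.\<close>

lemma emeasure_step_rest:
  assumes I: "finite I" "i \<notin> I"
    and E [measurable]: "Measurable.pred (borel \<Otimes>\<^sub>M PiM I (\<lambda>_. borel)) (\<lambda>p. E (fst p) (snd p))"
  shows "emeasure M {\<omega>\<in>space M. E (\<xi> i \<omega>) (rest I \<omega>)} =
    (\<integral>\<^sup>+\<omega>. emeasure F {x. E x (rest I \<omega>)} \<partial>M)"
proof -
  let ?L = "PiM {i} (\<lambda>_. borel :: real measure)"
  let ?N = "PiM I (\<lambda>_. borel :: real measure)"
  let ?C = "distr M ?L (rest {i})"
  let ?D = "distr M ?N (rest I)"
  let ?P = "{p\<in>space (?L \<Otimes>\<^sub>M ?N). E (fst p i) (snd p)}"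
  have [measurable]: "rest I \<in> measurable M ?N" "rest {i} \<in> measurable M ?L" by measurable
  have [measurable]: "Measurable.pred (?L \<Otimes>\<^sub>M ?N) (\<lambda>p. E (fst p i) (snd p))"
    using measurable_compose[OF _ E, of "\<lambda>p. (fst p i, snd p)" "?L \<Otimes>\<^sub>M ?N"] by simp
  have P: "?P \<in> sets (?L \<Otimes>\<^sub>M ?N)" by measurable
  have "indep_var ?L (rest {i}) ?N (rest I)"
    using I by (intro indep_var_restrict[OF indep]) auto
  then have eq: "?C \<Otimes>\<^sub>M ?D = distr M (?L \<Otimes>\<^sub>M ?N) (\<lambda>\<omega>. (rest {i} \<omega>, rest I \<omega>))"
    by (simp add: indep_var_distribution_eq)
  interpret C: prob_space ?C by (rule prob_space_distr) measurable
  interpret D: prob_space ?D by (rule prob_space_distr) measurable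
  interpret CD: pair_sigma_finite ?C ?D ..
  have sCD: "sets (?C \<Otimes>\<^sub>M ?D) = sets (?L \<Otimes>\<^sub>M ?N)"
    by (intro sets_pair_measure_cong) auto
  have sec: "emeasure ?C ((\<lambda>g. (g, rest I \<omega>)) -` ?P) = emeasure F {x. E x (rest I \<omega>)}"
    if \<omega>: "\<omega> \<in> space M" for \<omega>
  proof -
    have r: "rest I \<omega> \<in> space ?N" by (auto simp: space_PiM)
    have "(\<lambda>x. (x, rest I \<omega>)) \<in> measurable borel (borel \<Otimes>\<^sub>M ?N)" using r by simp
    from measurable_compose[OF this E]
    have [measurable]: "Measurable.pred borel (\<lambda>x. E x (rest I \<omega>))" by simp
    have "(\<lambda>g. (g, rest I \<omega>)) -` ?P = {g\<in>space ?L. E (g i) (rest I \<omega>)}"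
      using r by (auto simp: space_pair_measure)
    moreover have "emeasure ?C {g\<in>space ?L. E (g i) (rest I \<omega>)} = emeasure M {\<omega>'\<in>space M. E (\<xi> i \<omega>') (rest I \<omega>)}"
      by (subst emeasure_distr) (auto simp: space_PiM intro!: arg_cong2[where f = emeasure])
    moreover have "emeasure (distr M borel (\<xi> i)) {x. E x (rest I \<omega>)} = emeasure M {\<omega>'\<in>space M. E (\<xi> i \<omega>') (rest I \<omega>)}"
      by (subst emeasure_distr) (auto intro!: arg_cong2[where f = emeasure])
    ultimately show ?thesis by (simp add: distr_eq)
  qed
  have "emeasure M {\<omega>\<in>space M. E (\<xi> i \<omega>) (rest I \<omega>)} = emeasure (?C \<Otimes>\<^sub>M ?D) ?P"
    unfolding eq using P
    by (subst emeasure_distr) (auto simp: space_pair_measure space_PiM intro!: arg_cong2[where f = emeasure])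
  also have "\<dots> = (\<integral>\<^sup>+y. emeasure ?C ((\<lambda>x. (x, y)) -` ?P) \<partial>?D)"
    using P sCD by (intro CD.emeasure_pair_measure_alt2) simp
  also have "\<dots> = (\<integral>\<^sup>+\<omega>. emeasure ?C ((\<lambda>x. (x, rest I \<omega>)) -` ?P) \<partial>M)"
    using CD.measurable_emeasure_Pair2[of ?P] P sCD by (intro nn_integral_distr) auto
  also have "\<dots> = (\<integral>\<^sup>+\<omega>. emeasure F {x. E x (rest I \<omega>)} \<partial>M)"
    by (intro nn_integral_cong sec)
  finally show ?thesis .
qed

lemma prob_step_rest_le:
  assumes I: "finite I" "i \<notin> I"
    and E: "Measurable.pred (borel \<Otimes>\<^sub>M PiM I (\<lambda>_. borel)) (\<lambda>p. E (fst p) (snd p))"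
    and le: "\<And>\<omega>. \<omega> \<in> space M \<Longrightarrow> measure F {x. E x (rest I \<omega>)} \<le> c1 + c2 * indicator A \<omega>"
    and A: "A \<in> events" and c: "0 \<le> c1" "0 \<le> c2"
  shows "prob {\<omega>\<in>space M. E (\<xi> i \<omega>) (rest I \<omega>)} \<le> c1 + c2 * prob A"
proof -
  have "ennreal (prob {\<omega>\<in>space M. E (\<xi> i \<omega>) (rest I \<omega>)}) = (\<integral>\<^sup>+\<omega>. emeasure F {x. E x (rest I \<omega>)} \<partial>M)"
    using emeasure_step_rest[OF I E] unfolding emeasure_eq_measure .
  also have "\<dots> \<le> (\<integral>\<^sup>+\<omega>. ennreal (c1 + c2 * indicator A \<omega>) \<partial>M)"
    using le by (intro nn_integral_mono) (auto simp: F.emeasure_eq_measure intro!: ennreal_leI)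
  also have "\<dots> = ennreal (\<integral>\<omega>. c1 + c2 * indicator A \<omega> \<partial>M)"
    using A c by (intro nn_integral_eq_integral) (auto simp: emeasure_eq_measure intro!: integrable_real_indicator integrable_mult_right Bochner_Integration.integrable_add)
  also have "(\<integral>\<omega>. c1 + c2 * indicator A \<omega> \<partial>M) = c1 + c2 * prob A"
    using A by (subst Bochner_Integration.integral_add) (auto simp: emeasure_eq_measure prob_space intro!: integrable_real_indicator integrable_mult_right)
  finally show ?thesis using c by (subst (asm) ennreal_le_iff) auto
qed

lemma prob_step_rest_ge:
  assumes I: "finite I" "i \<notin> I"
    and E: "Measurable.pred (borel \<Otimes>\<^sub>M PiM I (\<lambda>_. borel)) (\<lambda>p. E (fst p) (snd p))"
    and le: "\<And>\<omega>. \<omega> \<in> A \<Longrightarrow> c \<le> measure F {x. E x (rest I \<omega>)}"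
    and A: "A \<in> events" and c: "0 \<le> c"
  shows "c * prob A \<le> prob {\<omega>\<in>space M. E (\<xi> i \<omega>) (rest I \<omega>)}"
proof -
  have "ennreal (c * prob A) = (\<integral>\<^sup>+\<omega>. ennreal c * indicator A \<omega> \<partial>M)"
    using A c by (subst nn_integral_cmult_indicator) (auto simp: emeasure_eq_measure ennreal_mult)
  also have "\<dots> \<le> (\<integral>\<^sup>+\<omega>. emeasure F {x. E x (rest I \<omega>)} \<partial>M)"
    using le by (intro nn_integral_mono) (auto simp: F.emeasure_eq_measure indicator_def intro!: ennreal_leI)
  also have "\<dots> = ennreal (prob {\<omega>\<in>space M. E (\<xi> i \<omega>) (rest I \<omega>)})"
    using emeasure_step_rest[OF I E] unfolding emeasure_eq_measure by (rule sym)
  finally show ?thesis by (subst (asm) ennreal_le_iff) auto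
qed

section \<open>A single large step\<close>

lemma sum_remove: "finite I \<Longrightarrow> i \<in> I \<Longrightarrow> (\<Sum>j\<in>I. \<xi> j \<omega>) = \<xi> i \<omega> + (\<Sum>j\<in>I - {i}. rest (I - {i}) \<omega> j)"
  by (simp add: sum.remove[of I i])

text \<open>If the other steps sum to less than \<open>r\<close> in modulus, the large step must hit
  a window close to \<open>x\<close>. Otherwise the crude bound \<open>c2\<close> is used, weighted
  by Chebyshev's \<open>card I / r\<^sup>2\<close>; that weight alone is not small compared with a
  window, so the product needs \<open>c2\<close> of the order of the window at
  \<open>x\<close>.\<close>

lemma big_jump_le:
  assumes I: "finite I" "i \<in> I" and r: "0 < r"
    and c1: "\<And>v. \<bar>v - x\<bar> \<le> r \<Longrightarrow> window F T v \<le> c1" "0 \<le> c1"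
    and c2: "\<And>v. measure F ((+) v ` Delta T \<inter> {u<..}) \<le> c2" "0 \<le> c2"
  shows "prob {\<omega>\<in>space M. (\<Sum>j\<in>I. \<xi> j \<omega>) \<in> (+) x ` Delta T \<and> u < \<xi> i \<omega>} \<le> c1 + c2 * (card I / r\<^sup>2)"
proof -
  let ?J = "I - {i}"
  let ?A = "{\<omega>\<in>space M. r \<le> \<bar>\<Sum>j\<in>?J. \<xi> j \<omega>\<bar>}"
  let ?E = "\<lambda>y g. y + (\<Sum>j\<in>?J. g j) \<in> (+) x ` Delta T \<and> u < y"
  have "prob {\<omega>\<in>space M. ?E (\<xi> i \<omega>) (rest ?J \<omega>)} \<le> c1 + c2 * prob ?A"
  proof (rule prob_step_rest_le)
    show "Measurable.pred (borel \<Otimes>\<^sub>M PiM ?J (\<lambda>_. borel)) (\<lambda>p. ?E (fst p) (snd p))"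
      by measurable
    fix \<omega> assume w: "\<omega> \<in> space M"
    let ?s = "\<Sum>j\<in>?J. \<xi> j \<omega>"
    have E: "{y. ?E y (rest ?J \<omega>)} = (+) (x - ?s) ` Delta T \<inter> {u<..}"
      by (simp add: shifted_Delta_add Int_def)
    show "measure F {y. ?E y (rest ?J \<omega>)} \<le> c1 + c2 * indicator ?A \<omega>"
    proof (cases "\<omega> \<in> ?A")
      case True
      then show ?thesis unfolding E using c2(1)[of "x - ?s"] c1 by simp
    next
      case False
      have "measure F ((+) (x - ?s) ` Delta T \<inter> {u<..}) \<le> window F T (x - ?s)"
        unfolding window_def by (intro F.finite_measure_mono) auto
      also have "\<dots> \<le> c1" using False w by (intro c1) auto
      finally show ?thesis unfolding E using False by simp
    qed
  qed (use I c1 c2 in auto)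
  also have "prob ?A \<le> card ?J / r\<^sup>2" using I r by (intro sum_tail) auto
  also have "\<dots> \<le> card I / r\<^sup>2" using I by (intro divide_right_mono) (auto intro!: card_mono)
  finally show ?thesis using c2 I by (simp add: sum_remove mult_left_mono)
qed

text \<open>Requiring the other steps to stay below \<open>u\<close> makes the events for different
  \<open>i\<close> disjoint. The two subtracted terms are the prices of the two restrictions on the
  others: Chebyshev for their sum and a union bound for their maximum.\<close>

lemma big_jump_ge:
  assumes I: "finite I" "i \<in> I" and r: "0 < r" and u: "u \<le> x - r"
    and c: "\<And>v. \<bar>v - x\<bar> \<le> r \<Longrightarrow> c \<le> window F T v" "0 \<le> c"
  shows "c * (1 - card I / r\<^sup>2 - card I * measure F {u<..}) \<le>
    prob {\<omega>\<in>space M. (\<Sum>j\<in>I. \<xi> j \<omega>) \<in> (+) x ` Delta T \<and> u < \<xi> i \<omega> \<and> (\<forall>j\<in>I - {i}. \<xi> j \<omega> \<le> u)}"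
proof -
  let ?J = "I - {i}"
  let ?B = "{\<omega>\<in>space M. r \<le> \<bar>\<Sum>j\<in>?J. \<xi> j \<omega>\<bar>}"
  let ?C = "\<lambda>j. {\<omega>\<in>space M. \<xi> j \<omega> \<in> {u<..}}"
  let ?A = "{\<omega>\<in>space M. \<bar>\<Sum>j\<in>?J. \<xi> j \<omega>\<bar> < r \<and> (\<forall>j\<in>?J. \<xi> j \<omega> \<le> u)}"
  let ?E = "\<lambda>y g. y + (\<Sum>j\<in>?J. g j) \<in> (+) x ` Delta T \<and> u < y \<and> (\<forall>j\<in>?J. g j \<le> u)"
  have fin: "finite ?J" using I by simp
  have mC: "prob (?C j) = measure F {u<..}" for j
    using measure_distr[OF rv[of j], of "{u<..}"] by (simp add: distr_eq vimage_def Int_def conj_commute)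
  have "1 - prob ?A = prob (space M - ?A)"
    using fin by (subst prob_compl) auto
  also have "\<dots> \<le> prob (?B \<union> (\<Union>j\<in>?J. ?C j))"
    using fin by (intro finite_measure_mono) auto
  also have "\<dots> \<le> prob ?B + prob (\<Union>j\<in>?J. ?C j)"
    using fin by (intro measure_Un_le) auto
  also have "prob (\<Union>j\<in>?J. ?C j) \<le> (\<Sum>j\<in>?J. prob (?C j))"
    using fin by (intro measure_UNION_le) auto
  also have "\<dots> = card ?J * measure F {u<..}" by (simp only: mC sum_constant)
  also have "\<dots> \<le> card I * measure F {u<..}"
    using I by (intro mult_right_mono) (auto intro!: card_mono)
  also have "prob ?B \<le> card ?J / r\<^sup>2" using I r by (intro sum_tail) auto
  also have "\<dots> \<le> card I / r\<^sup>2" using I by (intro divide_right_mono) (auto intro!: card_mono)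
  finally have "1 - card I / r\<^sup>2 - card I * measure F {u<..} \<le> prob ?A" by simp
  then have "c * (1 - card I / r\<^sup>2 - card I * measure F {u<..}) \<le> c * prob ?A"
    using c by (intro mult_left_mono) auto
  also have "\<dots> \<le> prob {\<omega>\<in>space M. ?E (\<xi> i \<omega>) (rest ?J \<omega>)}"
  proof (rule prob_step_rest_ge)
    show "Measurable.pred (borel \<Otimes>\<^sub>M PiM ?J (\<lambda>_. borel)) (\<lambda>p. ?E (fst p) (snd p))"
      using fin by measurable
    show "?A \<in> events" using fin by measurable
    fix \<omega> assume w: "\<omega> \<in> ?A"
    let ?s = "\<Sum>j\<in>?J. \<xi> j \<omega>"
    \<comment> \<open>The shifted window lies above \<open>x - ?s > x - r \<ge> u\<close>, so the
      condition that the selected step exceeds \<open>u\<close> comes for free.\<close>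
    have "u < y" if "y \<in> (+) (x - ?s) ` Delta T" for y
      using that w u unfolding shifted_Delta by auto
    then have "{y. ?E y (rest ?J \<omega>)} = (+) (x - ?s) ` Delta T"
      using w by (auto simp: shifted_Delta_add simp del: image_iff)
    then show "c \<le> measure F {y. ?E y (rest ?J \<omega>)}"
      using c(1)[of "x - ?s"] w by (auto simp: window_def)
  qed (use I c in auto)
  finally show ?thesis using I by (simp add: sum_remove)
qed

lemma prob_le_sum_jumps:
  assumes "finite I" and [measurable]: "B \<in> sets borel"
  shows "prob {\<omega>\<in>space M. (\<Sum>j\<in>I. \<xi> j \<omega>) \<in> B} \<le>
    prob {\<omega>\<in>space M. (\<Sum>j\<in>I. \<xi> j \<omega>) \<in> B \<and> (\<forall>j\<in>I. \<xi> j \<omega> \<le> u)} +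
    (\<Sum>i\<in>I. prob {\<omega>\<in>space M. (\<Sum>j\<in>I. \<xi> j \<omega>) \<in> B \<and> u < \<xi> i \<omega>})"
proof -
  let ?X = "{\<omega>\<in>space M. (\<Sum>j\<in>I. \<xi> j \<omega>) \<in> B \<and> (\<forall>j\<in>I. \<xi> j \<omega> \<le> u)}"
  let ?Y = "\<lambda>i. {\<omega>\<in>space M. (\<Sum>j\<in>I. \<xi> j \<omega>) \<in> B \<and> u < \<xi> i \<omega>}"
  have "prob {\<omega>\<in>space M. (\<Sum>j\<in>I. \<xi> j \<omega>) \<in> B} \<le> prob (?X \<union> (\<Union>i\<in>I. ?Y i))"
    using assms by (intro finite_measure_mono) auto
  also have "\<dots> \<le> prob ?X + prob (\<Union>i\<in>I. ?Y i)"
    using assms by (intro measure_Un_le) auto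
  also have "prob (\<Union>i\<in>I. ?Y i) \<le> (\<Sum>i\<in>I. prob (?Y i))"
    using assms by (intro measure_UNION_le) auto
  finally show ?thesis by simp
qed

lemma prob_ge_sum_jumps:
  assumes "finite I" and [measurable]: "B \<in> sets borel"
  shows "(\<Sum>i\<in>I. prob {\<omega>\<in>space M. (\<Sum>j\<in>I. \<xi> j \<omega>) \<in> B \<and> u < \<xi> i \<omega> \<and> (\<forall>j\<in>I - {i}. \<xi> j \<omega> \<le> u)})
    \<le> prob {\<omega>\<in>space M. (\<Sum>j\<in>I. \<xi> j \<omega>) \<in> B}"
proof -
  let ?Y = "\<lambda>i. {\<omega>\<in>space M. (\<Sum>j\<in>I. \<xi> j \<omega>) \<in> B \<and> u < \<xi> i \<omega> \<and> (\<forall>j\<in>I - {i}. \<xi> j \<omega> \<le> u)}"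
  have "(\<Sum>i\<in>I. prob (?Y i)) = prob (\<Union>i\<in>I. ?Y i)"
  proof (rule finite_measure_finite_Union[symmetric])
    show "disjoint_family_on ?Y I"
      unfolding disjoint_family_on_def
    proof (intro ballI impI equals0I)
      fix i j \<omega> assume "i \<in> I" "j \<in> I" "i \<noteq> j" "\<omega> \<in> ?Y i \<inter> ?Y j"
      then have "\<xi> i \<omega> \<le> u" "u < \<xi> i \<omega>" by blast+
      then show False by simp
    qed
  qed (use assms in auto)
  also have "\<dots> \<le> prob {\<omega>\<in>space M. (\<Sum>j\<in>I. \<xi> j \<omega>) \<in> B}"
    using assms by (intro finite_measure_mono) auto
  finally show ?thesis .
qed

section \<open>Sums of truncated steps under the tilt\<close>

lemma tilt_prod:
  fixes g :: "real \<Rightarrow> 'b::{banach, second_countable_topology, real_normed_field}"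
  assumes I: "finite I" and l: "0 \<le> l" and g [measurable]: "g \<in> borel_measurable borel" and "\<And>u. norm (g u) \<le> 1"
  shows "integrable M (\<lambda>\<omega>. \<Prod>j\<in>I. of_real (F.tilt l y (\<xi> j \<omega>)) * g (\<xi> j \<omega>))"
    and "(\<integral>\<omega>. (\<Prod>j\<in>I. of_real (F.tilt l y (\<xi> j \<omega>)) * g (\<xi> j \<omega>)) \<partial>M) =
      (\<integral>u. of_real (F.tilt l y u) * g u \<partial>F) ^ card I"
proof -
  let ?h = "\<lambda>u. of_real (F.tilt l y u) * g u"
  have hF: "integrable F ?h" using assms by (intro F.integrable_tilt_mult) auto
  have h: "?h \<in> borel_measurable borel" by measurable
  have ind: "indep_vars (\<lambda>_. borel) (\<lambda>j \<omega>. ?h (\<xi> j \<omega>)) I"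
    using h by (intro indep_vars_compose2[OF indep_vars_subset[OF indep]]) auto
  show "integrable M (\<lambda>\<omega>. \<Prod>j\<in>I. ?h (\<xi> j \<omega>))"
    using h hF by (intro indep_vars_integrable[OF I ind] integrable_step) auto
  have "(\<integral>\<omega>. (\<Prod>j\<in>I. ?h (\<xi> j \<omega>)) \<partial>M) = (\<Prod>j\<in>I. \<integral>\<omega>. ?h (\<xi> j \<omega>) \<partial>M)"
    using h hF by (intro indep_vars_lebesgue_integral[OF I ind] integrable_step) auto
  also have "\<dots> = (\<integral>u. ?h u \<partial>F) ^ card I"
    using integral_step[OF h] by simp
  finally show "(\<integral>\<omega>. (\<Prod>j\<in>I. ?h (\<xi> j \<omega>)) \<partial>M) = (\<integral>u. ?h u \<partial>F) ^ card I" .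
qed

lemma prod_tilt:
  assumes "finite I"
  shows "(\<Prod>j\<in>I. F.tilt l y (\<xi> j \<omega>)) =
    (if \<forall>j\<in>I. \<xi> j \<omega> \<le> y then exp (l * (\<Sum>j\<in>I. \<xi> j \<omega>)) else 0)"
proof (cases "\<forall>j\<in>I. \<xi> j \<omega> \<le> y")
  case True
  then show ?thesis using assms by (simp add: F.tilt_def exp_sum sum_distrib_left)
next
  case False
  then obtain j where j: "j \<in> I" "\<not> \<xi> j \<omega> \<le> y" by blast
  then have "F.tilt l y (\<xi> j \<omega>) = 0" by (simp add: F.tilt_def)
  with j show ?thesis unfolding if_not_P[OF False] by (intro prod_zero assms) blast
qed

text \<open>Markov's inequality for the product of the weights, which on this event is at least
  \<open>exp (l * x)\<close>.\<close>

lemma prob_truncated_le: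
  assumes I: "finite I" and l: "0 \<le> l"
  shows "prob {\<omega>\<in>space M. x < (\<Sum>j\<in>I. \<xi> j \<omega>) \<and> (\<forall>j\<in>I. \<xi> j \<omega> \<le> y)} \<le>
    exp (- l * x) * (\<integral>u. F.tilt l y u \<partial>F) ^ card I"
proof -
  let ?A = "{\<omega>\<in>space M. x < (\<Sum>j\<in>I. \<xi> j \<omega>) \<and> (\<forall>j\<in>I. \<xi> j \<omega> \<le> y)}"
  have [measurable]: "?A \<in> events" using I by measurable
  have "prob ?A = (\<integral>\<omega>. indicator ?A \<omega> \<partial>M)" by simp
  also have "\<dots> \<le> (\<integral>\<omega>. exp (- l * x) * (\<Prod>j\<in>I. F.tilt l y (\<xi> j \<omega>)) \<partial>M)"
  proof (rule integral_mono)
    show "integrable M (\<lambda>\<omega>. exp (- l * x) * (\<Prod>j\<in>I. F.tilt l y (\<xi> j \<omega>)))"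
      using tilt_prod(1)[OF I l, of "\<lambda>_. 1 :: real" y] by simp
    show "indicator ?A \<omega> \<le> exp (- l * x) * (\<Prod>j\<in>I. F.tilt l y (\<xi> j \<omega>))" for \<omega>
      using l by (auto simp: prod_tilt[OF I] indicator_def simp flip: exp_add intro!: mult_left_mono)
  qed (auto intro!: integrable_real_indicator simp: emeasure_eq_measure)
  also have "\<dots> = exp (- l * x) * (\<integral>u. F.tilt l y u \<partial>F) ^ card I"
    using tilt_prod(2)[OF I l, of "\<lambda>_. 1 :: real" y] by simp
  finally show ?thesis .
qed

text \<open>A finite form of Esseen's concentration inequality: \<open>\<bar>\<Sum>j<N. cis (a * j / N * v)\<bar>\<^sup>2\<close> is at least
  \<open>N\<^sup>2 / 4\<close> for \<open>0 \<le> a * v \<le> 1\<close>, and expanding it leaves only powers of the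
  characteristic function at frequencies in \<open>[-a, a]\<close>.\<close>

lemma prob_truncated_local_le:
  assumes R: "R \<ge> 1" "0 < measure F {-R..0}" "0 < measure F {1..R}" and r: "0 < r"
  shows "\<exists>C>0. \<forall>I l y x. finite I \<longrightarrow> I \<noteq> {} \<longrightarrow> 0 \<le> l \<longrightarrow> l \<le> 1 \<longrightarrow> R \<le> y \<longrightarrow> (\<integral>u. F.tilt l y u \<partial>F) \<le> 2 \<longrightarrow>
    prob {\<omega>\<in>space M. (\<Sum>j\<in>I. \<xi> j \<omega>) \<in> {x<..x + r} \<and> (\<forall>j\<in>I. \<xi> j \<omega> \<le> y)} \<le>
    C / sqrt (card I) * exp (- l * x) * (\<integral>u. F.tilt l y u \<partial>F) ^ card I"
proof -
  define c where "c = exp (- R) * measure F {-R..0} * measure F {1..R} / 4"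
  have c: "c > 0" using R by (simp add: c_def)
  \<comment> \<open>The bound \<open>1 / (2 * R)\<close> keeps all frequency differences where
    \<open>tilt_char_le\<close> applies; the bound \<open>1 / r\<close> keeps the phases at most 1
    across a window of length \<open>r\<close>.\<close>
  define a where "a = min (1 / (2 * R)) (1 / r)"
  have a: "a > 0" "a * (2 * R) \<le> 1" "a * r \<le> 1"
    using R r by (auto simp: a_def min_def field_simps)
  \<comment> \<open>The rate comes from \<open>real n * (c * \<theta>\<^sup>2 / 8)\<close> at a
    frequency difference \<open>\<theta> = a * m / N\<close>, using
    \<open>N\<^sup>2 \<le> 4 * n\<close> and \<open>m \<le> m\<^sup>2\<close>.\<close>
  define q where "q = exp (- (c * a\<^sup>2 / 32))"
  have q: "0 \<le> q" "q < 1" using c a by (auto simp: q_def)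
  define C where "C = 8 / (1 - q)"
  have C: "C > 0" using q by (simp add: C_def)
  have "prob {\<omega>\<in>space M. (\<Sum>j\<in>I. \<xi> j \<omega>) \<in> {x<..x + r} \<and> (\<forall>j\<in>I. \<xi> j \<omega> \<le> y)} \<le>
    C / sqrt (card I) * exp (- l * x) * (\<integral>u. F.tilt l y u \<partial>F) ^ card I"
    if I: "finite I" "I \<noteq> {}" and l: "0 \<le> l" "l \<le> 1" and y: "R \<le> y" and \<phi>2: "(\<integral>u. F.tilt l y u \<partial>F) \<le> 2"
    for I l y x
  proof -
    define n where "n = card I"
    have n: "n \<ge> 1" using I by (simp add: n_def Suc_le_eq card_gt_0_iff)
    define \<phi> where "\<phi> = (\<integral>u. F.tilt l y u \<partial>F)"
    have \<phi>0: "\<phi> \<ge> 0" by (simp add: \<phi>_def)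
    \<comment> \<open>About \<open>sqrt n\<close> frequencies at spacing of order
      \<open>1 / sqrt n\<close>: powers of order \<open>n\<close> of the characteristic function
      then decay geometrically in the index distance. Only pairs near the diagonal matter, and
      comparing \<open>N\<^sup>2\<close> with \<open>N\<close> yields the factor
      \<open>1 / sqrt n\<close>.\<close>
    define N where "N = nat \<lceil>sqrt n\<rceil>"
    have sn: "sqrt n \<ge> 1" using n by simp
    have N: "sqrt n \<le> real N" "real N \<le> 2 * sqrt n" "N > 0"
    proof -
      show "sqrt n \<le> real N" unfolding N_def by (rule real_nat_ceiling_ge)
      have "real N < sqrt n + 1" unfolding N_def using sn by linarith
      then show "real N \<le> 2 * sqrt n" using sn by linarith
      show "N > 0" using sn by (simp add: N_def)
    qed
    define t where "t j = a * real j / real N" for j :: nat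
    define W where "W \<omega> = (\<Prod>j\<in>I. F.tilt l y (\<xi> j \<omega>))" for \<omega>
    define S where "S \<omega> = (\<Sum>j\<in>I. \<xi> j \<omega>)" for \<omega>
    have W0: "W \<omega> \<ge> 0" for \<omega> by (auto simp: W_def intro: prod_nonneg)
    have Wc: "of_real (W \<omega>) * cis (\<theta> * S \<omega>) = (\<Prod>j\<in>I. of_real (F.tilt l y (\<xi> j \<omega>)) * cis (\<theta> * \<xi> j \<omega>))" for \<theta> \<omega>
      by (simp add: W_def S_def prod.distrib sum_distrib_left cis_conv_exp exp_sum[OF I(1)])
    have cism: "(\<lambda>u. cis (\<theta> * u)) \<in> borel_measurable borel" for \<theta> by (simp add: cis_conv_exp)
    have intWc: "integrable M (\<lambda>\<omega>. of_real (W \<omega>) * cis (\<theta> * S \<omega>))"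
      and WC: "(\<integral>\<omega>. of_real (W \<omega>) * cis (\<theta> * S \<omega>) \<partial>M) = F.tilt_char l y \<theta> ^ n" for \<theta>
      unfolding Wc F.tilt_char_def n_def using tilt_prod[OF I(1) l(1) cism] by auto
    have powle: "cmod (F.tilt_char l y (t j - t k)) ^ n \<le> \<phi> ^ n * q ^ nat \<bar>int j - int k\<bar>"
      if "j < N" "k < N" for j k
    proof -
      define m where "m = nat \<bar>int j - int k\<bar>"
      define \<theta> where "\<theta> = t j - t k"
      have jk: "\<bar>real j - real k\<bar> = real m" by (simp add: m_def)
      have \<theta>m: "\<bar>\<theta>\<bar> = a * real m / real N"
        using a N by (simp add: \<theta>_def t_def abs_mult jk flip: diff_divide_distrib right_diff_distrib)
      have "m \<le> N" using that by (auto simp: m_def)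
      then have "\<bar>\<theta>\<bar> \<le> a" using a N by (simp add: \<theta>m field_simps)
      then have "\<bar>\<theta>\<bar> * (2 * R) \<le> 1" using a R by (meson mult_right_mono order.trans zero_le_mult_iff zero_le_numeral zero_le_one)
      then have "(cmod (F.tilt_char l y \<theta>))\<^sup>2 \<le> \<phi>\<^sup>2 - c * \<theta>\<^sup>2"
        using F.tilt_char_le[OF R(1) l y] by (simp add: \<phi>_def c_def)
      \<comment> \<open>Since \<open>\<phi> \<le> 2\<close>, the absolute loss
        \<open>c * \<theta>\<^sup>2\<close> becomes a relative loss that survives taking
        \<open>n\<close>-th powers.\<close>
      also have "\<dots> \<le> \<phi>\<^sup>2 * (1 - c * \<theta>\<^sup>2 / 4)"
      proof -
        have "\<phi>\<^sup>2 \<le> 2\<^sup>2" using \<phi>2 \<phi>0 by (intro power_mono) (auto simp: \<phi>_def)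
        then have "\<phi>\<^sup>2 * (c * \<theta>\<^sup>2 / 4) \<le> 4 * (c * \<theta>\<^sup>2 / 4)"
          using c by (intro mult_right_mono) auto
        then show ?thesis by (simp add: algebra_simps)
      qed
      also have "\<dots> \<le> \<phi>\<^sup>2 * exp (- (c * \<theta>\<^sup>2 / 4))"
        using exp_ge_add_one_self[of "- (c * \<theta>\<^sup>2 / 4)"] by (intro mult_left_mono) auto
      also have "\<dots> = (\<phi> * exp (- (c * \<theta>\<^sup>2 / 8)))\<^sup>2"
        by (simp add: power_mult_distrib flip: exp_double)
      finally have "cmod (F.tilt_char l y \<theta>) \<le> \<phi> * exp (- (c * \<theta>\<^sup>2 / 8))"
        by (rule power2_le_imp_le) (use \<phi>0 in auto)
      then have "cmod (F.tilt_char l y \<theta>) ^ n \<le> (\<phi> * exp (- (c * \<theta>\<^sup>2 / 8))) ^ n"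
        by (rule power_mono) auto
      also have "\<dots> = \<phi> ^ n * exp (- (real n * (c * \<theta>\<^sup>2 / 8)))"
        by (simp add: power_mult_distrib flip: exp_of_nat_mult)
      also have "\<dots> \<le> \<phi> ^ n * q ^ m"
      proof (intro mult_left_mono)
        have "(real N)\<^sup>2 \<le> (2 * sqrt n)\<^sup>2" using N by (intro power_mono) auto
        then have N2: "(real N)\<^sup>2 \<le> 4 * n" by (simp add: power_mult_distrib)
        have "real m \<le> (real m)\<^sup>2" by (cases m) (auto simp: power2_eq_square)
        then have "a\<^sup>2 * real m * (real N)\<^sup>2 \<le> a\<^sup>2 * (real m)\<^sup>2 * (4 * n)"
          using N2 by (intro mult_mono mult_nonneg_nonneg) auto
        moreover have "\<theta>\<^sup>2 = a\<^sup>2 * (real m)\<^sup>2 / (real N)\<^sup>2"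
          using \<theta>m by (metis power2_abs power_divide power_mult_distrib)
        then have "4 * n * \<theta>\<^sup>2 * (real N)\<^sup>2 = a\<^sup>2 * (real m)\<^sup>2 * (4 * n)" using N by simp
        ultimately have "a\<^sup>2 * real m * (real N)\<^sup>2 \<le> 4 * n * \<theta>\<^sup>2 * (real N)\<^sup>2" by linarith
        then have "a\<^sup>2 * real m \<le> 4 * n * \<theta>\<^sup>2" 
          by (rule mult_right_le_imp_le) (use N in auto)
        then have "c * (a\<^sup>2 * real m) \<le> c * (4 * n * \<theta>\<^sup>2)" using c by (intro mult_left_mono) auto
        then have "exp (- (real n * (c * \<theta>\<^sup>2 / 8))) \<le> exp (- (real m * (c * a\<^sup>2 / 32)))"
          by (simp add: algebra_simps)
        also have "\<dots> = q ^ m" by (simp add: q_def flip: exp_of_nat_mult)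
        finally show "exp (- (real n * (c * \<theta>\<^sup>2 / 8))) \<le> q ^ m" .
      qed (use \<phi>0 in auto)
      finally show ?thesis by (simp add: \<theta>_def m_def)
    qed
    define A where "A = {\<omega>\<in>space M. S \<omega> \<in> {x<..x + r} \<and> (\<forall>j\<in>I. \<xi> j \<omega> \<le> y)}"
    have A[measurable]: "A \<in> events" using I unfolding A_def S_def by measurable
    \<comment> \<open>A nonnegative kernel of Fejer type. As a finite sum of characters it can be
      integrated term by term against the tilted law.\<close>
    define K where "K v = (cmod (\<Sum>j<N. cis (t j * v)))\<^sup>2" for v
    have K: "complex_of_real (K v) = (\<Sum>j<N. \<Sum>k<N. cis ((t j - t k) * v))" for v
      unfolding K_def complex_norm_square
      by (simp add: sum_product cis_cnj cis_mult left_diff_distrib)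
    have Kge: "(real N)\<^sup>2 / 4 \<le> K v" if v: "0 \<le> v" "v \<le> r" for v
    proof -
      have "1 / 2 \<le> cos (t j * v)" if "j < N" for j
      proof (rule cos_ge_half)
        have "t j \<le> a" "0 \<le> t j" using that a N by (auto simp: t_def field_simps)
        then have "t j * v \<le> a * r" "0 \<le> t j * v" using v a by (auto intro!: mult_mono)
        then show "\<bar>t j * v\<bar> \<le> 1" using a by simp
      qed
      then have "(\<Sum>j<N. 1 / 2) \<le> (\<Sum>j<N. cos (t j * v))" by (intro sum_mono) auto
      also have "\<dots> = Re (\<Sum>j<N. cis (t j * v))" by simp
      also have "\<dots> \<le> cmod (\<Sum>j<N. cis (t j * v))" by (rule complex_Re_le_cmod)
      finally have "(real N / 2)\<^sup>2 \<le> K v" unfolding K_def by (intro power_mono) auto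
      then show ?thesis by (simp add: power_divide)
    qed
    let ?E = "\<lambda>j k \<omega>. of_real (W \<omega>) * cis ((t j - t k) * (S \<omega> - x))"
    have Eeq: "?E j k \<omega> = cis (- ((t j - t k) * x)) * (of_real (W \<omega>) * cis ((t j - t k) * S \<omega>))" for j k \<omega>
      by (simp add: cis_mult right_diff_distrib mult.left_commute)
    have intE: "integrable M (?E j k)" for j k
      unfolding Eeq using intWc by simp
    have KW: "complex_of_real (W \<omega> * K (S \<omega> - x)) = (\<Sum>j<N. \<Sum>k<N. ?E j k \<omega>)" for \<omega>
      by (simp add: K sum_distrib_left)
    have "integrable M (\<lambda>\<omega>. complex_of_real (W \<omega> * K (S \<omega> - x)))"
      unfolding KW using intE by auto
    then have intK: "integrable M (\<lambda>\<omega>. W \<omega> * K (S \<omega> - x))"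
      using integrable_Re by fastforce
    have "(\<integral>\<omega>. W \<omega> * K (S \<omega> - x) \<partial>M) = cmod (\<integral>\<omega>. complex_of_real (W \<omega> * K (S \<omega> - x)) \<partial>M)"
    proof -
      have "0 \<le> (\<integral>\<omega>. W \<omega> * K (S \<omega> - x) \<partial>M)"
        by (intro integral_nonneg_AE AE_I2) (simp add: W0 K_def)
      then show ?thesis by (simp add: integral_complex_of_real del: of_real_mult)
    qed
    also have "\<dots> = cmod (\<Sum>j<N. \<Sum>k<N. \<integral>\<omega>. ?E j k \<omega> \<partial>M)"
      unfolding KW using intE by (simp add: Bochner_Integration.integral_sum)
    also have "\<dots> \<le> (\<Sum>j<N. \<Sum>k<N. cmod (\<integral>\<omega>. ?E j k \<omega> \<partial>M))"
      by (intro order.trans[OF norm_sum] sum_mono norm_sum)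
    also have "\<dots> = (\<Sum>j<N. \<Sum>k<N. cmod (F.tilt_char l y (t j - t k)) ^ n)"
      unfolding Eeq using WC by (simp add: norm_mult norm_power)
    also have "\<dots> \<le> (\<Sum>j<N. \<Sum>k<N. \<phi> ^ n * q ^ nat \<bar>int j - int k\<bar>)"
      using powle by (intro sum_mono) auto
    also have "\<dots> = \<phi> ^ n * (\<Sum>j<N. \<Sum>k<N. q ^ nat \<bar>int j - int k\<bar>)"
      by (simp add: sum_distrib_left)
    also have "\<dots> \<le> \<phi> ^ n * (\<Sum>j<N. 2 / (1 - q))"
      using \<phi>0 q by (intro mult_left_mono sum_mono sum_power_dist_le) auto
    finally have EK: "(\<integral>\<omega>. W \<omega> * K (S \<omega> - x) \<partial>M) \<le> \<phi> ^ n * (real N * (2 / (1 - q)))"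
      by simp
    have "(real N)\<^sup>2 / 4 * exp (l * x) * prob A = (\<integral>\<omega>. (real N)\<^sup>2 / 4 * exp (l * x) * indicator A \<omega> \<partial>M)"
      by simp
    also have "\<dots> \<le> (\<integral>\<omega>. W \<omega> * K (S \<omega> - x) \<partial>M)"
    proof (intro integral_mono intK)
      fix \<omega>
      show "(real N)\<^sup>2 / 4 * exp (l * x) * indicator A \<omega> \<le> W \<omega> * K (S \<omega> - x)"
      proof (cases "\<omega> \<in> A")
        case True
        then have "exp (l * x) \<le> W \<omega>"
          using l by (auto simp: A_def W_def prod_tilt[OF I(1)] S_def intro!: mult_left_mono)
        moreover have "(real N)\<^sup>2 / 4 \<le> K (S \<omega> - x)"
          using True by (intro Kge) (auto simp: A_def)
        ultimately have "exp (l * x) * ((real N)\<^sup>2 / 4) \<le> W \<omega> * K (S \<omega> - x)"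
          using W0 by (intro mult_mono) auto
        then show ?thesis using True by (simp add: mult_ac)
      qed (simp add: W0 K_def)
    qed (auto intro!: integrable_real_indicator integrable_mult_right simp: emeasure_eq_measure)
    finally have "(real N)\<^sup>2 / 4 * exp (l * x) * prob A \<le> \<phi> ^ n * (real N * (2 / (1 - q)))"
      using EK by linarith
    then have "real N * (prob A * real N * exp (l * x)) \<le> real N * (C * \<phi> ^ n)"
      by (simp add: C_def power2_eq_square mult_ac)
    then have "prob A * real N * exp (l * x) \<le> C * \<phi> ^ n"
      by (rule mult_left_le_imp_le) (use N in auto)
    then have "prob A \<le> C / real N * exp (- l * x) * \<phi> ^ n"
      using N by (simp add: field_simps exp_minus)
    also have "\<dots> \<le> C / sqrt n * exp (- l * x) * \<phi> ^ n"
      using N C \<phi>0 n by (intro mult_right_mono divide_left_mono mult_pos_pos) auto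
    finally show ?thesis by (simp add: A_def S_def n_def \<phi>_def)
  qed
  then show ?thesis using C by blast
qed

end

section \<open>Large deviations\<close>

lemma powr_ln_tendsto_0:
  fixes s r :: real
  assumes "0 < s"
  shows "((\<lambda>x. x powr (- s) * ln x powr r) \<longlongrightarrow> 0) at_top"
  using assms by real_asymp

text \<open>Up to logarithms the expression is \<open>x powr (p + \<alpha>)\<close>. It will bound
  the total excess weight of the steps between the breakpoint \<open>h * x / (A * ln x)\<close> and
  the cut.\<close>

lemma truncation_tendsto_0:
  fixes A h p \<alpha> K :: real
  assumes "0 < A" "0 < h" "p + \<alpha> < 0"
  shows "((\<lambda>x. K * x powr p * (h * x / (A * ln x)) powr \<alpha>) \<longlongrightarrow> 0) at_top"
proof -
  have "((\<lambda>x. K * (h / A) powr \<alpha> * (x powr (- (- (p + \<alpha>))) * ln x powr (- \<alpha>))) \<longlongrightarrow> 0) at_top"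
    using assms by (intro tendsto_mult_right_zero powr_ln_tendsto_0) auto
  moreover have "\<forall>\<^sub>F x in at_top. K * (h / A) powr \<alpha> * (x powr (- (- (p + \<alpha>))) * ln x powr (- \<alpha>)) =
      K * x powr p * (h * x / (A * ln x)) powr \<alpha>"
    using eventually_gt_at_top[of 1]
  proof eventually_elim
    case (elim x)
    then have "h * x / (A * ln x) = (h / A) * (x / ln x)" "ln x > 0" by auto
    then show ?case using elim assms
      by (simp add: powr_mult powr_divide powr_add powr_minus field_simps)
  qed
  ultimately show ?thesis by (rule Lim_transform_eventually)
qed

text \<open>The second factor is the value of \<open>x powr b\<close> at
  \<open>x\<^sup>2 = A * n * ln (A * n)\<close>, which will bound \<open>x\<close> in the Gaussian
  range.\<close>

lemma gaussian_regime_tendsto_0: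
  fixes A b p :: real
  assumes "0 < A" "b / 2 < p"
  shows "(\<lambda>n. real n powr (- p) * (A * real n * ln (A * real n)) powr (b / 2)) \<longlonglongrightarrow> 0"
proof -
  have "filterlim (\<lambda>n. A * real n) at_top sequentially" using assms by real_asymp
  from filterlim_compose[OF powr_ln_tendsto_0[of "p - b / 2" "b / 2"] this]
  have "(\<lambda>n. A powr p * ((A * real n) powr (- (p - b / 2)) * ln (A * real n) powr (b / 2))) \<longlonglongrightarrow> 0"
    using assms by (intro tendsto_mult_right_zero) auto
  moreover have "\<forall>\<^sub>F n in sequentially. 1 < A * real n"
    using assms by real_asymp
  then have "\<forall>\<^sub>F n in sequentially. A powr p * ((A * real n) powr (- (p - b / 2)) * ln (A * real n) powr (b / 2)) =
      real n powr (- p) * (A * real n * ln (A * real n)) powr (b / 2)"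
  proof eventually_elim
    case (elim n)
    then have "ln (A * real n) > 0" by (rule ln_gt_zero)
    moreover have "real n > 0" using elim by (cases n) auto
    moreover have "(A * real n) powr (- (p - b / 2)) = (A * real n) powr (- p) * (A * real n) powr (b / 2)"
      by (simp flip: powr_add)
    ultimately show ?case using assms
      by (simp add: powr_mult powr_minus)
  qed
  ultimately show ?thesis by (rule Lim_transform_eventually)
qed

section \<open>Negligibility of the event without a large step\<close>

context iid_walk
begin

text \<open>The exponent \<open>q\<close> merges the two cases: Markov's inequality for
  \<open>q = 0\<close>, concentration for \<open>q = 1\<close>. For finite \<open>T\<close> the
  positive window beyond \<open>X \<ge> 1\<close> supplies the mass on \<open>{1..}\<close> from
  which the spread of the step is obtained.\<close>

lemma prob_truncated_window_le:
  assumes T: "0 < T" and q: "q = (if T = \<infinity> then 0 else 1 :: real)"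
    and X: "1 \<le> X" "0 < window F T X"
  shows "\<exists>G>0. \<exists>R. \<forall>n\<ge>1. \<forall>l y x. 0 \<le> l \<longrightarrow> l \<le> 1 \<longrightarrow> R \<le> y \<longrightarrow> (\<integral>u. F.tilt l y u \<partial>F) \<le> 2 \<longrightarrow>
    prob {\<omega>\<in>space M. (\<Sum>j=1..n. \<xi> j \<omega>) \<in> (+) x ` Delta T \<and> (\<forall>j\<in>{1..n}. \<xi> j \<omega> \<le> y)} \<le>
    G * real n powr (- q / 2) * exp (- l * x) * (\<integral>u. F.tilt l y u \<partial>F) ^ n"
proof (cases T)
  case (real r)
  then have r: "r > 0" using T by simp
  have W: "(+) x ` Delta T = {x<..x + r}" for x
    by (intro set_eqI) (auto simp only: shifted_Delta real, auto)
  have "window F T X \<le> measure F {1..}"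
    unfolding window_def W using X by (intro F.finite_measure_mono) auto
  then have "0 < measure F {1..}" using X by linarith
  then obtain R where R: "R \<ge> 1" "0 < measure F {-R..0}" "0 < measure F {1..R}"
    using F.exists_spread by blast
  from prob_truncated_local_le[OF R r] obtain C where C: "C > 0"
    and CI: "\<And>I l y x. finite I \<Longrightarrow> I \<noteq> {} \<Longrightarrow> 0 \<le> l \<Longrightarrow> l \<le> 1 \<Longrightarrow> R \<le> y \<Longrightarrow> (\<integral>u. F.tilt l y u \<partial>F) \<le> 2 \<Longrightarrow>
    prob {\<omega>\<in>space M. (\<Sum>j\<in>I. \<xi> j \<omega>) \<in> {x<..x + r} \<and> (\<forall>j\<in>I. \<xi> j \<omega> \<le> y)} \<le>
    C / sqrt (card I) * exp (- l * x) * (\<integral>u. F.tilt l y u \<partial>F) ^ card I" by blast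
  have "real n powr (- q / 2) = 1 / sqrt (real n)" if "n \<ge> 1" for n
    using that q real by (simp add: powr_minus powr_half_sqrt field_simps)
  then show ?thesis
    using C CI[of "{1.._}"] unfolding W by (intro exI[of _ C] exI[of _ R] conjI allI impI) auto
next
  case PInf
  have W: "z \<in> (+) x ` Delta T \<longleftrightarrow> x < z" for x z
    unfolding shifted_Delta PInf by simp
  show ?thesis
    using prob_truncated_le[of "{1.._}"] q PInf unfolding W
    by (intro exI[of _ 1] exI[of _ 0] conjI allI impI) auto
qed (use T in auto)

text \<open>The tilting parameter is \<open>l = min (x / n) (A * ln x / x)\<close>: the first value is optimal in the
  Gaussian range, and the second keeps \<open>exp (l * \<delta> * x)\<close> below \<open>x powr (\<delta> * A)\<close> beyond it.
  Both satisfy \<open>n * l\<^sup>2 \<le> l * x\<close>.\<close>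

lemma truncated_bound:
  fixes T :: ereal and q \<alpha> \<rho> K X0 :: real
  assumes T: "0 < T" and q: "q = (if T = \<infinity> then 0 else 1)"
    and X0: "1 \<le> X0" "0 < window F T X0"
    and up: "\<And>w. X0 \<le> w \<Longrightarrow> window F T w \<le> K * w powr \<alpha>" and K: "0 < K"
    and \<alpha>: "\<alpha> < - 2 - q" and \<rho>: "0 < \<rho>" "\<rho> < 1" and A: "0 < A"
  shows "\<exists>\<delta> G X1. 0 < \<delta> \<and> \<delta> \<le> 1 / 2 \<and> 0 < G \<and> (\<forall>x\<ge>X1. \<forall>n\<ge>1. real n \<le> x\<^sup>2 \<longrightarrow>
    prob {\<omega>\<in>space M. (\<Sum>j=1..n. \<xi> j \<omega>) \<in> (+) x ` Delta T \<and> (\<forall>j\<in>{1..n}. \<xi> j \<omega> \<le> \<delta> * x)} \<le>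
    G * real n powr (- q / 2) * exp (- (\<rho> / 2) * min (x\<^sup>2 / n) (A * ln x)))"
proof -
  obtain G R where G: "G > 0" and GR: "\<And>n l y x. n \<ge> 1 \<Longrightarrow> 0 \<le> l \<Longrightarrow> l \<le> 1 \<Longrightarrow> R \<le> y \<Longrightarrow> (\<integral>u. F.tilt l y u \<partial>F) \<le> 2 \<Longrightarrow>
    prob {\<omega>\<in>space M. (\<Sum>j=1..n. \<xi> j \<omega>) \<in> (+) x ` Delta T \<and> (\<forall>j\<in>{1..n}. \<xi> j \<omega> \<le> y)} \<le>
    G * real n powr (- q / 2) * exp (- l * x) * (\<integral>u. F.tilt l y u \<partial>F) ^ n"
    using prob_truncated_window_le[OF T q X0] by blast
  \<comment> \<open>With \<open>exp h = 2 - \<rho>\<close> the tilted mass contributes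
    \<open>(2 - \<rho>) / 2 * (l * x)\<close> to the exponent, which leaves
    \<open>- (\<rho> / 2) * (l * x)\<close> after the factor \<open>exp (- l * x)\<close>.\<close>
  define h where "h = ln (2 - \<rho>)"
  have h: "0 < h" "exp h = 2 - \<rho>" using \<rho> by (auto simp: h_def)
  have q0: "0 \<le> q" using q by simp
  \<comment> \<open>The weight exponent \<open>\<delta> * A\<close> may use up at most half of the
    slack \<open>- (2 + q + \<alpha>)\<close>.\<close>
  define \<delta> where "\<delta> = min (1 / 2) (- (2 + q + \<alpha>) / (2 * A))"
  have \<delta>: "0 < \<delta>" "\<delta> \<le> 1 / 2" using \<alpha> A by (auto simp: \<delta>_def)
  have "\<delta> * A \<le> - (2 + q + \<alpha>) / (2 * A) * A" using A by (intro mult_right_mono) (auto simp: \<delta>_def)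
  then have \<delta>A: "2 + \<delta> * A + q + \<alpha> < 0" using A \<alpha> by simp
  define K' where "K' = K * (1 / real_of_ereal T + 1)"
  have lims: "((\<lambda>x. A * ln x / x) \<longlongrightarrow> 0) at_top" "filterlim (\<lambda>x. h * x / (A * ln x)) at_top at_top"
    "filterlim (\<lambda>x. \<delta> * x) at_top at_top"
    using A h \<delta> by real_asymp+
  have "\<forall>\<^sub>F x in at_top. A * ln x / x < 1 / 2"
    using order_tendstoD(2)[OF lims(1), of "1 / 2"] by simp
  moreover have "\<forall>\<^sub>F x in at_top. X0 \<le> h * x / (A * ln x)"
    using lims(2) by (simp add: filterlim_at_top)
  moreover have "\<forall>\<^sub>F x in at_top. R \<le> \<delta> * x"
    using lims(3) by (simp add: filterlim_at_top)
  moreover have "\<forall>\<^sub>F x in at_top. K' * x powr (2 + \<delta> * A + q) * (h * x / (A * ln x)) powr \<alpha> < 1 / 2"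
    using order_tendstoD(2)[OF truncation_tendsto_0[OF A h(1) \<delta>A, of K'], of "1 / 2"] by simp
  ultimately have "\<forall>\<^sub>F x in at_top. x > 1 \<and> A * ln x / x < 1 / 2 \<and> X0 \<le> h * x / (A * ln x) \<and> R \<le> \<delta> * x \<and>
      K' * x powr (2 + \<delta> * A + q) * (h * x / (A * ln x)) powr \<alpha> < 1 / 2"
    using eventually_gt_at_top[of 1] by eventually_elim auto
  then obtain X1 where X1: "\<And>x. x \<ge> X1 \<Longrightarrow> x > 1" "\<And>x. x \<ge> X1 \<Longrightarrow> A * ln x / x < 1 / 2"
    "\<And>x. x \<ge> X1 \<Longrightarrow> X0 \<le> h * x / (A * ln x)" "\<And>x. x \<ge> X1 \<Longrightarrow> R \<le> \<delta> * x"
    "\<And>x. x \<ge> X1 \<Longrightarrow> K' * x powr (2 + \<delta> * A + q) * (h * x / (A * ln x)) powr \<alpha> < 1 / 2"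
    unfolding eventually_at_top_linorder by blast
  have "prob {\<omega>\<in>space M. (\<Sum>j=1..n. \<xi> j \<omega>) \<in> (+) x ` Delta T \<and> (\<forall>j\<in>{1..n}. \<xi> j \<omega> \<le> \<delta> * x)} \<le>
    (G * exp 1) * real n powr (- q / 2) * exp (- (\<rho> / 2) * min (x\<^sup>2 / n) (A * ln x))"
    if x: "x \<ge> X1" and n: "n \<ge> 1" "real n \<le> x\<^sup>2" for x n
  proof -
    have x1: "x > 1" and lx: "ln x > 0" using X1(1)[OF x] by auto
    define l where "l = min (x / n) (A * ln x / x)"
    have l: "0 < l" "l \<le> x / n" "l \<le> A * ln x / x"
      using x1 lx A n by (auto simp: l_def)
    then have l2: "l < 1 / 2" using X1(2)[OF x] by linarith
    have lx_eq: "l * x = min (x\<^sup>2 / n) (A * ln x)"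
      using x1 by (simp add: l_def min_mult_distrib_right power2_eq_square)
    \<comment> \<open>The breakpoint up to which \<open>l * u \<le> h\<close>, so that the quadratic
      bound applies.\<close>
    define v where "v = h / l"
    have v: "0 < v" "l * v \<le> h" using h l by (auto simp: v_def)
    have hv: "h * x / (A * ln x) \<le> v"
    proof -
      have "h / (A * ln x / x) \<le> h / l" using l h A lx x1 by (intro divide_left_mono) auto
      then show ?thesis by (simp add: v_def)
    qed
    have hx0: "0 < h * x / (A * ln x)" using X1(3)[OF x] X0 by linarith
    define \<phi> where "\<phi> = (\<integral>u. F.tilt l (\<delta> * x) u \<partial>F)"
    have \<phi>0: "0 \<le> \<phi>" by (simp add: \<phi>_def)
    \<comment> \<open>The part of the tilted mass beyond \<open>v\<close>. Counting powers of
      \<open>x\<close> in \<open>real n * z\<close>: 2 from \<open>n \<le> x\<^sup>2\<close>,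
      \<open>\<delta> * A\<close> from the weight, \<open>q\<close> from the windows and
      \<open>\<alpha>\<close>, up to logarithms, from \<open>v\<close>. The total is negative, so
      this part costs at most a constant factor in \<open>\<phi> ^ n\<close>.\<close>
    define z where "z = exp (l * (\<delta> * x)) * measure F {v<..\<delta> * x}"
    have z: "0 \<le> z" "real n * z \<le> 1 / 2"
    proof -
      show "0 \<le> z" by (simp add: z_def)
      have "z \<le> x powr (\<delta> * A) * (K' * x powr q * (h * x / (A * ln x)) powr \<alpha>)"
        unfolding z_def
      proof (intro mult_mono)
        have "l * x \<le> A * ln x" by (simp add: lx_eq)
        then have "\<delta> * (l * x) \<le> \<delta> * (A * ln x)" using \<delta> by (intro mult_left_mono) auto
        then show "exp (l * (\<delta> * x)) \<le> x powr (\<delta> * A)"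
          using x1 by (simp add: powr_def mult_ac)
        have "measure F {v<..\<delta> * x} \<le> K' * x powr q * v powr \<alpha>"
          unfolding K'_def
        proof (rule F.interval_le_windows[OF T X0(1) _ _ up q])
          show "X0 \<le> v" using hv X1(3)[OF x] by linarith
          show "\<delta> * x \<le> x" using \<delta> x1 by (simp add: mult_le_cancel_right1)
        qed (use \<alpha> q0 K x1 in auto)
        also have "\<dots> \<le> K' * x powr q * (h * x / (A * ln x)) powr \<alpha>"
          using hv hx0 \<alpha> q0 K T unfolding K'_def
          by (intro mult_left_mono powr_mono2' mult_nonneg_nonneg) (auto simp: real_of_ereal_pos less_imp_le)
        finally show "measure F {v<..\<delta> * x} \<le> K' * x powr q * (h * x / (A * ln x)) powr \<alpha>" .
      qed auto
      then have "real n * z \<le> x\<^sup>2 * (x powr (\<delta> * A) * (K' * x powr q * (h * x / (A * ln x)) powr \<alpha>))"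
        using n \<open>0 \<le> z\<close> by (intro mult_mono) auto
      also have "x\<^sup>2 = x powr 2" using x1 by simp
      also have "x powr 2 * (x powr (\<delta> * A) * (K' * x powr q * (h * x / (A * ln x)) powr \<alpha>)) =
          K' * x powr (2 + \<delta> * A + q) * (h * x / (A * ln x)) powr \<alpha>"
        by (simp add: powr_add mult_ac)
      finally show "real n * z \<le> 1 / 2" using X1(5)[OF x] by linarith
    qed
    have "\<phi> \<le> 1 + exp h * l\<^sup>2 / 2 + z"
      unfolding \<phi>_def z_def using l h v \<delta> x1 by (intro F.integral_tilt_le) auto
    then have \<phi>1: "\<phi> \<le> 1 + ((2 - \<rho>) / 2 * l\<^sup>2 + z)" by (simp add: h)
    have \<phi>2: "\<phi> \<le> 2"
    proof -
      have "l\<^sup>2 \<le> (1 / 2)\<^sup>2" using l l2 by (intro power_mono) auto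
      then have "l\<^sup>2 \<le> 1 / 4" by (simp add: power_divide)
      then have "(2 - \<rho>) / 2 * l\<^sup>2 \<le> 1 * (1 / 4)" using \<rho> by (intro mult_mono) auto
      moreover have "1 * z \<le> real n * z" using n z by (intro mult_right_mono) auto
      ultimately show ?thesis using \<phi>1 z by linarith
    qed
    have "\<phi> \<le> exp ((2 - \<rho>) / 2 * l\<^sup>2 + z)" using \<phi>1 exp_ge_add_one_self by (rule order_trans)
    then have "\<phi> ^ n \<le> exp ((2 - \<rho>) / 2 * l\<^sup>2 + z) ^ n" using \<phi>0 by (rule power_mono)
    also have "\<dots> = exp ((2 - \<rho>) / 2 * (real n * l * l) + real n * z)"
      by (simp add: power2_eq_square algebra_simps flip: exp_of_nat_mult)
    also have "\<dots> \<le> exp ((2 - \<rho>) / 2 * (l * x) + 1)"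
    proof -
      have "real n * l * l \<le> x * l" using l n by (intro mult_right_mono) (auto simp: field_simps)
      then have "(2 - \<rho>) / 2 * (real n * l * l) \<le> (2 - \<rho>) / 2 * (l * x)"
        using \<rho> by (intro mult_left_mono) (auto simp: mult.commute)
      then show ?thesis using z by simp
    qed
    finally have \<phi>n: "\<phi> ^ n \<le> exp ((2 - \<rho>) / 2 * (l * x) + 1)" .
    have "prob {\<omega>\<in>space M. (\<Sum>j=1..n. \<xi> j \<omega>) \<in> (+) x ` Delta T \<and> (\<forall>j\<in>{1..n}. \<xi> j \<omega> \<le> \<delta> * x)} \<le>
      G * real n powr (- q / 2) * exp (- l * x) * \<phi> ^ n"
      unfolding \<phi>_def using n l l2 X1(4)[OF x] \<phi>2 by (intro GR) (auto simp: \<phi>_def)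
    also have "\<dots> \<le> G * real n powr (- q / 2) * exp (- l * x) * exp ((2 - \<rho>) / 2 * (l * x) + 1)"
      using \<phi>n G by (intro mult_left_mono) auto
    also have "\<dots> = (G * exp 1) * real n powr (- q / 2) * (exp (- l * x) * exp ((2 - \<rho>) / 2 * (l * x)))"
      by (simp add: exp_add mult_ac)
    also have "exp (- l * x) * exp ((2 - \<rho>) / 2 * (l * x)) = exp (- (\<rho> / 2) * (l * x))"
      unfolding exp_add[symmetric] by (simp add: field_simps)
    finally show ?thesis unfolding lx_eq .
  qed
  then show ?thesis using \<delta> G
    by (intro exI[of _ \<delta>] exI[of _ "G * exp 1"] exI[of _ X1]) auto
qed

text \<open>The minimum in the exponent gives two ranges. Where \<open>A * ln x\<close> is smaller,
  the bound is a power of \<open>x\<close> below \<open>x powr (- b)\<close>. In the Gaussian range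
  \<open>x\<^sup>2\<close> exceeds \<open>n\<close> only by a logarithm, so powers of
  \<open>x\<close> and of \<open>n\<close> can be compared.\<close>

lemma truncated_negligible:
  fixes T :: ereal and q b \<alpha> K X0 c0 t :: real
  assumes T: "0 < T" and q: "q = (if T = \<infinity> then 0 else 1)"
    and X0: "1 \<le> X0" "0 < window F T X0"
    and up: "\<And>w. X0 \<le> w \<Longrightarrow> window F T w \<le> K * w powr \<alpha>" and K: "0 < K"
    and \<alpha>: "\<alpha> < - 2 - q"
    and lo: "\<And>w. X0 \<le> w \<Longrightarrow> c0 * w powr (- b) \<le> window F T w" and c0: "0 < c0"
    and b: "0 < b" "b < t + 2 + q" and t: "0 < t"
  shows "\<exists>\<delta>. 0 < \<delta> \<and> \<delta> \<le> 1 / 2 \<and> (\<forall>e>0. \<forall>\<^sub>F n in sequentially. \<forall>x\<ge>sqrt (t * real n * ln (real n)).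
    prob {\<omega>\<in>space M. (\<Sum>j=1..n. \<xi> j \<omega>) \<in> (+) x ` Delta T \<and> (\<forall>j\<in>{1..n}. \<xi> j \<omega> \<le> \<delta> * x)} \<le>
    e * (real n * window F T x))"
proof -
  \<comment> \<open>\<open>s\<close> is the critical exponent factor:
    \<open>b = s * t + 2 + q\<close>. The hypothesis on \<open>b\<close> says \<open>s < 1\<close>,
    which leaves room for \<open>\<rho>\<close> strictly between \<open>s\<close> and 1; the maximum
    with \<open>1 / 2\<close> covers negative \<open>s\<close>.\<close>
  define s where "s = (b - 2 - q) / t"
  have s: "s < 1" "s * t = b - 2 - q" using b t by (auto simp: s_def field_simps)
  define \<rho> where "\<rho> = max (1 / 2) ((1 + s) / 2)"
  have \<rho>: "0 < \<rho>" "\<rho> < 1" "s < \<rho>" using s by (auto simp: \<rho>_def less_max_iff_disj)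
  have "s * t < \<rho> * t" using \<rho> t by (intro mult_strict_right_mono) auto
  then have \<rho>b: "b / 2 < q / 2 + 1 + \<rho> * t / 2" using s by linarith
  \<comment> \<open>Chosen so that \<open>exp (- (\<rho> / 2) * (A * ln x))\<close> is
    \<open>x powr (- (b + 1))\<close>, one power of \<open>x\<close> better than required.\<close>
  define A where "A = 2 * (b + 1) / \<rho>"
  have A: "0 < A" "\<rho> / 2 * A = b + 1" "1 \<le> A" using b \<rho> by (auto simp: A_def field_simps)
  obtain \<delta> G X1 where \<delta>: "0 < \<delta>" "\<delta> \<le> 1 / 2" and G: "0 < G"
    and X1: "\<And>x n. x \<ge> X1 \<Longrightarrow> n \<ge> 1 \<Longrightarrow> real n \<le> x\<^sup>2 \<Longrightarrow>
      prob {\<omega>\<in>space M. (\<Sum>j=1..n. \<xi> j \<omega>) \<in> (+) x ` Delta T \<and> (\<forall>j\<in>{1..n}. \<xi> j \<omega> \<le> \<delta> * x)} \<le>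
      G * real n powr (- q / 2) * exp (- (\<rho> / 2) * min (x\<^sup>2 / n) (A * ln x))"
    using truncated_bound[OF T q X0 up K \<alpha> \<rho>(1,2) A(1)] by blast
  have "\<forall>\<^sub>F n in sequentially. \<forall>x\<ge>sqrt (t * real n * ln (real n)).
    prob {\<omega>\<in>space M. (\<Sum>j=1..n. \<xi> j \<omega>) \<in> (+) x ` Delta T \<and> (\<forall>j\<in>{1..n}. \<xi> j \<omega> \<le> \<delta> * x)} \<le>
    e * (real n * window F T x)" if e: "e > 0" for e
  proof -
    \<comment> \<open>The last entry lets the spare factor \<open>1 / x\<close> absorb the constants
      \<open>G\<close>, \<open>c0\<close> and \<open>e\<close> in the range of very large
      \<open>x\<close>.\<close>
    define X2 where "X2 = max (max X0 X1) (max 1 (G / (c0 * e)))"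
    have "filterlim (\<lambda>n. sqrt (t * real n * ln (real n))) at_top sequentially"
      using t by real_asymp
    then have "\<forall>\<^sub>F n in sequentially. X2 \<le> sqrt (t * real n * ln (real n))"
      by (simp add: filterlim_at_top)
    moreover have "\<forall>\<^sub>F n in sequentially. 1 \<le> t * ln (real n)"
      using t by real_asymp
    moreover have "(\<lambda>n. real n powr (- (q / 2 + 1 + \<rho> * t / 2)) * (A * real n * ln (A * real n)) powr (b / 2)) \<longlonglongrightarrow> 0"
      by (rule gaussian_regime_tendsto_0[OF A(1) \<rho>b])
    then have "\<forall>\<^sub>F n in sequentially. real n powr (- (q / 2 + 1 + \<rho> * t / 2)) * (A * real n * ln (A * real n)) powr (b / 2) < e * c0 / G"
      using e c0 G by (intro order_tendstoD(2)) auto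
    ultimately show ?thesis using eventually_ge_at_top[of 1]
    proof eventually_elim
      case (elim n)
      have n1: "real n \<ge> 1" "real n > 0" using elim by auto
      show ?case
      proof (intro allI impI)
        fix x assume x: "sqrt (t * real n * ln (real n)) \<le> x"
        then have xX: "X2 \<le> x" using elim by linarith
        have xs: "X0 \<le> x" "X1 \<le> x" "1 \<le> x" "0 < x" "G / (c0 * e) \<le> x" using xX by (auto simp: X2_def)
        have "t * real n * ln (real n) \<le> x\<^sup>2"
          using x xs by (simp add: real_sqrt_le_iff' sqrt_le_D)
        then have xn: "t * ln (real n) \<le> x\<^sup>2 / real n" using n1 by (simp add: field_simps)
        then have "1 \<le> x\<^sup>2 / real n" using elim by linarith
        then have nx: "real n \<le> x\<^sup>2" using n1 by (simp add: field_simps)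
        have f: "c0 * x powr (- b) \<le> window F T x" using lo xs by blast
        define P where "P = prob {\<omega>\<in>space M. (\<Sum>j=1..n. \<xi> j \<omega>) \<in> (+) x ` Delta T \<and> (\<forall>j\<in>{1..n}. \<xi> j \<omega> \<le> \<delta> * x)}"
        have P: "P \<le> G * real n powr (- q / 2) * exp (- (\<rho> / 2) * min (x\<^sup>2 / n) (A * ln x))"
          unfolding P_def using X1 xs elim nx by blast
        have "P \<le> e * (real n * (c0 * x powr (- b)))"
        proof (cases "A * ln x \<le> x\<^sup>2 / n")
          case True
          have "exp (- (\<rho> / 2) * (A * ln x)) = exp (- (\<rho> / 2 * A) * ln x)" by (simp add: mult_ac)
          also have "\<dots> = x powr (- (b + 1))" using xs unfolding A(2) by (simp add: powr_def)
          also have "\<dots> = x powr (- b) / x" using xs by (simp add: powr_diff)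
          finally have "P \<le> G * real n powr (- q / 2) * (x powr (- b) / x)" using P True by (simp add: min_absorb2)
          also have "\<dots> \<le> G * 1 * (x powr (- b) / x)"
          proof (intro mult_right_mono mult_left_mono)
            have "0 \<le> q" using q by simp
            then show "real n powr (- q / 2) \<le> 1" using n1 powr_mono[of "- q / 2" 0 "real n"] by simp
          qed (use G xs in auto)
          also have "\<dots> = G / x * x powr (- b)" by simp
          also have "\<dots> \<le> e * c0 * x powr (- b)"
            using xs c0 e by (intro mult_right_mono) (auto simp: field_simps)
          also have "\<dots> = e * (1 * (c0 * x powr (- b)))" by simp
          also have "\<dots> \<le> e * (real n * (c0 * x powr (- b)))"
            using n1 e c0 by (intro mult_left_mono mult_right_mono) auto
          finally show ?thesis .
        next
          case False
          then have xA: "x\<^sup>2 \<le> A * real n * ln x" using n1 by (simp add: field_simps)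
          \<comment> \<open>A crude first use of \<open>x\<^sup>2 \<le> A * n * ln x\<close> gives
            \<open>x \<le> A * n\<close>; putting this back into the logarithm bounds
            \<open>x\<^sup>2\<close> by a function of \<open>n\<close> alone.\<close>
          have "ln x \<le> x" using xs ln_le_minus_one[of x] by linarith
          then have "A * real n * ln x \<le> A * real n * x" using A n1 by (intro mult_left_mono) auto
          then have "x * x \<le> A * real n * x" using xA by (simp add: power2_eq_square)
          then have "x \<le> A * real n" using xs by simp
          then have "ln x \<le> ln (A * real n)" using xs A n1 by simp
          then have "A * real n * ln x \<le> A * real n * ln (A * real n)" using A n1 by (intro mult_left_mono) auto
          then have "x\<^sup>2 \<le> A * real n * ln (A * real n)" using xA by linarith
          then have "(x\<^sup>2) powr (b / 2) \<le> (A * real n * ln (A * real n)) powr (b / 2)"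
            using b by (intro powr_mono2) auto
          moreover have "(x\<^sup>2) powr (b / 2) = x powr b"
            using xs by (simp add: powr_powr flip: powr_numeral)
          ultimately have xb: "x powr b \<le> (A * real n * ln (A * real n)) powr (b / 2)" by simp
          have "exp (- (\<rho> / 2) * (x\<^sup>2 / n)) \<le> exp (- (\<rho> / 2) * (t * ln (real n)))"
            using mult_left_mono[OF xn, of "\<rho> / 2"] \<rho> by simp
          also have "\<dots> = real n powr (- (\<rho> * t / 2))" using n1 by (simp add: powr_def)
          finally have ex: "exp (- (\<rho> / 2) * (x\<^sup>2 / n)) \<le> real n powr (- (\<rho> * t / 2))" .
          have "P \<le> G * real n powr (- q / 2) * exp (- (\<rho> / 2) * (x\<^sup>2 / n))" using P False by (simp add: min_absorb1)
          also have "\<dots> \<le> G * real n powr (- q / 2) * real n powr (- (\<rho> * t / 2))"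
            using ex G by (intro mult_left_mono) auto
          also have "\<dots> = G * real n * (real n powr (- (q / 2 + 1 + \<rho> * t / 2)) * x powr b) * x powr (- b)"
          proof -
            have "real n powr (- q / 2) * real n powr (- (\<rho> * t / 2)) = real n powr 1 * real n powr (- (q / 2 + 1 + \<rho> * t / 2))"
              by (simp only: powr_add[symmetric]) (simp add: algebra_simps)
            moreover have "x powr b * x powr (- b) = 1" using xs by (simp flip: powr_add)
            ultimately show ?thesis using n1 by (simp add: mult_ac)
          qed
          also have "\<dots> \<le> G * real n * (e * c0 / G) * x powr (- b)"
          proof (intro mult_right_mono mult_left_mono)
            have "real n powr (- (q / 2 + 1 + \<rho> * t / 2)) * x powr b \<le>
              real n powr (- (q / 2 + 1 + \<rho> * t / 2)) * (A * real n * ln (A * real n)) powr (b / 2)"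
              using xb by (intro mult_left_mono) auto
            then show "real n powr (- (q / 2 + 1 + \<rho> * t / 2)) * x powr b \<le> e * c0 / G"
              using elim by linarith
          qed (use G in auto)
          also have "\<dots> = e * (real n * (c0 * x powr (- b)))" using G by simp
          finally show ?thesis .
        qed
        also have "\<dots> \<le> e * (real n * window F T x)"
          using f e n1 by (intro mult_left_mono) auto
        finally show "prob {\<omega>\<in>space M. (\<Sum>j=1..n. \<xi> j \<omega>) \<in> (+) x ` Delta T \<and> (\<forall>j\<in>{1..n}. \<xi> j \<omega> \<le> \<delta> * x)} \<le>
          e * (real n * window F T x)" unfolding P_def .
      qed
    qed
  qed
  then show ?thesis using \<delta> by blast
qed

text \<open>The three multiples of \<open>e\<close> in the upper bound are the event without a large
  step, the replacement of nearby windows by the one at \<open>x\<close>, and the Chebyshev event.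
  The lower bound loses \<open>(1 - e) * (1 - e)\<close>, from nearby windows and from the
  restrictions on the other steps.\<close>

lemma big_jump_uniform:
  fixes T :: ereal and q b \<alpha> K D X0 t :: real
  assumes T: "0 < T" and q: "q = (if T = \<infinity> then 0 else 1)"
    and X0: "1 \<le> X0" "\<And>w. X0 \<le> w \<Longrightarrow> 0 < window F T w"
    and irv: "intermediate_regularly_varying (window F T)"
    and up: "\<And>x y. X0 \<le> x \<Longrightarrow> 1 \<le> y \<Longrightarrow> window F T (x * y) \<le> K * y powr \<alpha> * window F T x" and K: "0 < K"
    and \<alpha>: "\<alpha> < - 2 - q"
    and lo: "\<And>x y. X0 \<le> x \<Longrightarrow> 1 \<le> y \<Longrightarrow> D * y powr (- b) * window F T x \<le> window F T (x * y)" and D: "0 < D"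
    and b: "0 < b" "b < t + 2 + q" and t: "0 < t" and e: "0 < e" "e < 1"
  shows "\<forall>\<^sub>F n in sequentially. \<forall>x\<ge>sqrt (t * real n * ln (real n)).
    \<bar>prob {\<omega>\<in>space M. (\<Sum>j=1..n. \<xi> j \<omega>) \<in> (+) x ` Delta T} / (real n * window F T x) - 1\<bar> \<le> 3 * e"
proof -
  let ?f = "window F T"
  have q0: "0 \<le> q" using q by simp
  have scale: "X0 * (w / X0) = w" "1 \<le> w / X0" if "X0 \<le> w" for w using that X0(1) by auto
  \<comment> \<open>Anchoring the two-point bounds at \<open>X0\<close> turns them into pure power
    bounds.\<close>
  have up': "?f w \<le> K * X0 powr (- \<alpha>) * ?f X0 * w powr \<alpha>" if "X0 \<le> w" for w
    using up[of X0 "w / X0"] scale[OF that] that X0(1) by (simp add: powr_divide powr_minus field_simps)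
  have lo': "D * X0 powr b * ?f X0 * w powr (- b) \<le> ?f w" if "X0 \<le> w" for w
    using lo[of X0 "w / X0"] scale[OF that] that X0(1) by (simp add: powr_divide powr_minus field_simps)
  have f0: "0 < ?f X0" using X0 by blast
  obtain \<delta> where \<delta>: "0 < \<delta>" "\<delta> \<le> 1 / 2"
    and neg: "\<And>e. e > 0 \<Longrightarrow> \<forall>\<^sub>F n in sequentially. \<forall>x\<ge>sqrt (t * real n * ln (real n)).
      prob {\<omega>\<in>space M. (\<Sum>j=1..n. \<xi> j \<omega>) \<in> (+) x ` Delta T \<and> (\<forall>j\<in>{1..n}. \<xi> j \<omega> \<le> \<delta> * x)} \<le>
      e * (real n * window F T x)"
    using truncated_negligible[OF T q X0(1) f0 up' _ \<alpha> lo' _ b t] K D f0 X0(1) by auto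
  obtain d0 where d0: "0 < d0" "\<forall>\<^sub>F x in at_top. \<forall>z. \<bar>z\<bar> \<le> d0 * x \<longrightarrow> \<bar>?f (x - z) / ?f x - 1\<bar> \<le> e"
    using irv_shift[OF irv e(1)] by blast
  then obtain X1 where X1: "\<And>x z. X1 \<le> x \<Longrightarrow> \<bar>z\<bar> \<le> d0 * x \<Longrightarrow> \<bar>?f (x - z) / ?f x - 1\<bar> \<le> e"
    unfolding eventually_at_top_linorder by blast
  define d where "d = min d0 (1 / 2)"
  have d: "0 < d" "d \<le> d0" "d \<le> 1 / 2" using d0 by (auto simp: d_def)
  \<comment> \<open>The comparison constant between a window starting beyond
    \<open>\<delta> / 2 * x\<close> and the one at \<open>x\<close>: \<open>K\<close> for moving
    down to \<open>\<delta> / 2 * x\<close>, the remaining factor for moving from there up to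
    \<open>x\<close>.\<close>
  define C where "C = K / (D * (2 / \<delta>) powr (- b))"
  have C: "0 < C" using K D \<delta> by (simp add: C_def)
  define L where "L = real_of_ereal T"
  have L: "0 \<le> L" using T by (simp add: L_def real_of_ereal_pos less_imp_le)
  \<comment> \<open>The term \<open>2 * L / \<delta>\<close> ensures
    \<open>\<delta> * x - L \<ge> \<delta> / 2 * x\<close>: a window of finite length that meets
    \<open>{\<delta> * x<..}\<close> may start up to \<open>L\<close> earlier.\<close>
  define X2 where "X2 = max (max X1 1) (max (2 * X0 / \<delta>) (2 * L / \<delta>))"
  have near: "(1 - e) * ?f x \<le> ?f v" "?f v \<le> (1 + e) * ?f x"
    if "X2 \<le> x" "0 < ?f x" "\<bar>v - x\<bar> \<le> d * x" for x v
  proof -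
    have "d * x \<le> d0 * x" using d that by (intro mult_right_mono) (auto simp: X2_def)
    then have "\<bar>x - v\<bar> \<le> d0 * x" using that(3) by linarith
    then have "\<bar>?f (x - (x - v)) / ?f x - 1\<bar> \<le> e"
      using that by (intro X1) (auto simp: X2_def)
    then have "\<bar>?f v / ?f x - 1\<bar> \<le> e" by simp
    then show "(1 - e) * ?f x \<le> ?f v" "?f v \<le> (1 + e) * ?f x"
      using that(2) by (auto simp: abs_le_iff field_simps)
  qed
  have far: "?f v \<le> C * ?f x" if x: "X2 \<le> x" and v: "\<delta> * x - L \<le> v" for x v
  proof -
    define w where "w = \<delta> / 2 * x"
    have "2 * X0 / \<delta> \<le> x" "2 * L / \<delta> \<le> x" using x by (auto simp: X2_def)
    then have w: "X0 \<le> w" "L \<le> w" using \<delta> by (auto simp: w_def field_simps)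
    have wv: "w \<le> v" using v w by (simp add: w_def)
    have w0: "0 < w" using w X0 by linarith
    have "?f v \<le> K * (v / w) powr \<alpha> * ?f w" using up[of w "v / w"] w w0 wv by simp
    also have "\<dots> \<le> K * 1 * ?f w"
      using K X0(2)[OF w(1)] wv w0 \<alpha> q0 powr_mono[of \<alpha> 0 "v / w"] by (intro mult_right_mono mult_left_mono) auto
    also have "\<dots> \<le> K * (1 / (D * (2 / \<delta>) powr (- b)) * ?f x)"
    proof -
      have "D * (2 / \<delta>) powr (- b) * ?f w \<le> ?f (w * (2 / \<delta>))"
        using w \<delta> by (intro lo) (auto simp: field_simps)
      also have "w * (2 / \<delta>) = x" using \<delta> by (simp add: w_def)
      finally have "?f w \<le> 1 / (D * (2 / \<delta>) powr (- b)) * ?f x"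
        using D \<delta> by (simp add: field_simps)
      then show ?thesis using K unfolding mult_1_right by (intro mult_left_mono) auto
    qed
    also have "\<dots> = C * ?f x" by (simp add: C_def)
    finally show ?thesis .
  qed
  have "filterlim (\<lambda>n. sqrt (t * real n * ln (real n))) at_top sequentially"
    using t by real_asymp
  then have "\<forall>\<^sub>F n in sequentially. max X0 X2 \<le> sqrt (t * real n * ln (real n))"
    unfolding filterlim_at_top by blast
  \<comment> \<open>Chebyshev's terms are multiples of
    \<open>n / x\<^sup>2 \<le> 1 / (t * ln n)\<close>, so the logarithm in the lower end of the
    range is what makes them vanish. The 4 comes from the tail at \<open>x / 2\<close>.\<close>
  moreover have "\<forall>\<^sub>F n in sequentially. C * (1 / (d\<^sup>2 * (t * ln (real n)))) \<le> e"
    "\<forall>\<^sub>F n in sequentially. (1 / d\<^sup>2 + 4) * (1 / (t * ln (real n))) \<le> e"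
    "\<forall>\<^sub>F n in sequentially. 1 \<le> t * ln (real n)"
    using t d e by real_asymp+
  ultimately show ?thesis using neg[OF e(1)] eventually_ge_at_top[of 1]
  proof eventually_elim
    case (elim n)
    show ?case
    proof (intro allI impI)
      fix x assume x: "sqrt (t * real n * ln (real n)) \<le> x"
      have n1: "real n \<ge> 1" "real n > 0" using elim by auto
      have xX: "X0 \<le> x" "X2 \<le> x" using x elim(1) by linarith+
      have x0: "x > 0" using xX X0 by linarith
      have fx: "?f x > 0" using X0 xX by blast
      have "t * real n * ln (real n) \<le> x\<^sup>2" using x x0 by (simp add: sqrt_le_D)
      then have "t * ln (real n) \<le> x\<^sup>2 / real n" using n1 by (simp add: field_simps)
      moreover have "0 < t * ln (real n)" using elim by linarith
      ultimately have "1 / (x\<^sup>2 / real n) \<le> 1 / (t * ln (real n))" by (intro frac_le) simp_all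
      then have nx: "real n / x\<^sup>2 \<le> 1 / (t * ln (real n))" by simp
      define r where "r = d * x"
      have r: "0 < r" using d x0 by (simp add: r_def)
      have nr: "real n / r\<^sup>2 = 1 / d\<^sup>2 * (real n / x\<^sup>2)" by (simp add: r_def power_mult_distrib)
      have nr': "C * (real n / r\<^sup>2) \<le> e"
      proof -
        have "C * (real n / r\<^sup>2) \<le> C * (1 / d\<^sup>2 * (1 / (t * ln (real n))))"
          unfolding nr using nx C by (intro mult_left_mono) auto
        then show ?thesis using elim by simp
      qed
      let ?I = "{1..n}"
      let ?P = "prob {\<omega>\<in>space M. (\<Sum>j\<in>?I. \<xi> j \<omega>) \<in> (+) x ` Delta T}"
      have "?P \<le> prob {\<omega>\<in>space M. (\<Sum>j\<in>?I. \<xi> j \<omega>) \<in> (+) x ` Delta T \<and> (\<forall>j\<in>?I. \<xi> j \<omega> \<le> \<delta> * x)} +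
          (\<Sum>i\<in>?I. prob {\<omega>\<in>space M. (\<Sum>j\<in>?I. \<xi> j \<omega>) \<in> (+) x ` Delta T \<and> \<delta> * x < \<xi> i \<omega>})"
        by (rule prob_le_sum_jumps) auto
      also have "\<dots> \<le> e * (real n * ?f x) + (\<Sum>i\<in>?I. (1 + e) * ?f x + C * ?f x * (card ?I / r\<^sup>2))"
      proof (intro add_mono sum_mono)
        show "prob {\<omega>\<in>space M. (\<Sum>j\<in>?I. \<xi> j \<omega>) \<in> (+) x ` Delta T \<and> (\<forall>j\<in>?I. \<xi> j \<omega> \<le> \<delta> * x)} \<le> e * (real n * ?f x)"
          using elim x by blast
        fix i assume i: "i \<in> ?I"
        show "prob {\<omega>\<in>space M. (\<Sum>j\<in>?I. \<xi> j \<omega>) \<in> (+) x ` Delta T \<and> \<delta> * x < \<xi> i \<omega>} \<le> (1 + e) * ?f x + C * ?f x * (card ?I / r\<^sup>2)"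
        proof (rule big_jump_le[OF _ i r])
          show "?f v \<le> (1 + e) * ?f x" if "\<bar>v - x\<bar> \<le> r" for v
            using near(2) xX fx that by (simp add: r_def)
          show "measure F ((+) v ` Delta T \<inter> {\<delta> * x<..}) \<le> C * ?f x" for v
            using far[OF xX(2)] C fx unfolding L_def by (intro F.window_cut_le[OF T]) auto
        qed (use e C fx in auto)
      qed
      also have "\<dots> = real n * ?f x * (1 + 2 * e + C * (real n / r\<^sup>2))" by (simp add: algebra_simps)
      also have "\<dots> \<le> real n * ?f x * (1 + 3 * e)"
        using nr' n1 fx by (intro mult_left_mono) auto
      finally have upper: "?P / (real n * ?f x) \<le> 1 + 3 * e" using n1 fx by (simp add: field_simps)
      have tail: "measure F {x / 2<..} \<le> 4 / x\<^sup>2" using tail_le[of "x / 2"] x0 by (simp add: power_divide)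
      have "real n * ?f x * (1 - 3 * e) \<le> real n * ((1 - e) * ?f x * (1 - e))"
      proof -
        have "1 - 3 * e \<le> (1 - e) * (1 - e)" using e by (simp add: algebra_simps)
        then have "real n * ?f x * (1 - 3 * e) \<le> real n * ?f x * ((1 - e) * (1 - e))"
          using n1 fx by (intro mult_left_mono) auto
        then show ?thesis by (simp add: mult_ac)
      qed
      also have "\<dots> = (\<Sum>i\<in>?I. (1 - e) * ?f x * (1 - e))" by simp
      also have "\<dots> \<le> (\<Sum>i\<in>?I. prob {\<omega>\<in>space M. (\<Sum>j\<in>?I. \<xi> j \<omega>) \<in> (+) x ` Delta T \<and> x / 2 < \<xi> i \<omega> \<and>
          (\<forall>j\<in>?I - {i}. \<xi> j \<omega> \<le> x / 2)})"
      proof (intro sum_mono)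
        fix i assume i: "i \<in> ?I"
        have "real n / r\<^sup>2 + real n * measure F {x / 2<..} \<le> 1 / d\<^sup>2 * (real n / x\<^sup>2) + real n * (4 / x\<^sup>2)"
          unfolding nr using tail by (intro add_mono mult_left_mono) auto
        also have "\<dots> = (1 / d\<^sup>2 + 4) * (real n / x\<^sup>2)" by (simp add: algebra_simps)
        also have "\<dots> \<le> (1 / d\<^sup>2 + 4) * (1 / (t * ln (real n)))"
          using nx by (intro mult_left_mono) auto
        also have "\<dots> \<le> e" using elim by blast
        finally have "1 - e \<le> 1 - card ?I / r\<^sup>2 - card ?I * measure F {x / 2<..}" by simp
        then have "(1 - e) * ?f x * (1 - e) \<le> (1 - e) * ?f x * (1 - card ?I / r\<^sup>2 - card ?I * measure F {x / 2<..})"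
          using e fx by (intro mult_left_mono) auto
        also have "\<dots> \<le> prob {\<omega>\<in>space M. (\<Sum>j\<in>?I. \<xi> j \<omega>) \<in> (+) x ` Delta T \<and> x / 2 < \<xi> i \<omega> \<and>
            (\<forall>j\<in>?I - {i}. \<xi> j \<omega> \<le> x / 2)}"
        proof (rule big_jump_ge[OF _ i r])
          have "d * x \<le> 1 / 2 * x" using d x0 by (intro mult_right_mono) auto
          then show "x / 2 \<le> x - r" by (simp add: r_def)
          show "(1 - e) * ?f x \<le> ?f v" if "\<bar>v - x\<bar> \<le> r" for v
            using near(1) xX fx that by (simp add: r_def)
        qed (use e fx in auto)
        finally show "(1 - e) * ?f x * (1 - e) \<le> prob {\<omega>\<in>space M. (\<Sum>j\<in>?I. \<xi> j \<omega>) \<in> (+) x ` Delta T \<and> x / 2 < \<xi> i \<omega> \<and>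
            (\<forall>j\<in>?I - {i}. \<xi> j \<omega> \<le> x / 2)}" .
      qed
      also have "\<dots> \<le> ?P" by (rule prob_ge_sum_jumps) auto
      finally have lower: "1 - 3 * e \<le> ?P / (real n * ?f x)" using n1 fx by (simp add: field_simps)
      show "\<bar>?P / (real n * ?f x) - 1\<bar> \<le> 3 * e" using upper lower by (simp add: abs_le_iff)
    qed
  qed
qed

end

section \<open>From the indices to the uniform limit\<close>

theorem theorem8p1:
  fixes M :: "'a measure" and \<xi> :: "nat \<Rightarrow> 'a \<Rightarrow> real" and F :: "real measure"
    and S :: "nat \<Rightarrow> 'a \<Rightarrow> real" and T :: ereal and t :: real
  defines "S \<equiv> \<lambda>n \<omega>. \<Sum>i=1..n. \<xi> i \<omega>"
  assumes "prob_space M"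
    and "prob_space.indep_vars M (\<lambda>_. borel) \<xi> UNIV"
    and "\<And>i. distr M borel (\<xi> i) = F"
    and "0 < T"
    and "integrable M (\<xi> 0)" and "(\<integral>\<omega>. \<xi> 0 \<omega> \<partial>M) = 0"
    and "integrable M (\<lambda>\<omega>. (\<xi> 0 \<omega>)\<^sup>2)" and "(\<integral>\<omega>. (\<xi> 0 \<omega>)\<^sup>2 \<partial>M) = 1"
    and "intermediate_regularly_varying (window F T)"
    and "T = \<infinity> \<Longrightarrow> upper_Matuszewska_index (window F T) < - 2"
    and "T = \<infinity> \<Longrightarrow> ereal t > - lower_Matuszewska_index (window F T) - 2"
    and "T < \<infinity> \<Longrightarrow> upper_Matuszewska_index (window F T) < - 3"
    and "T < \<infinity> \<Longrightarrow> ereal t > - lower_Matuszewska_index (window F T) - 3"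
  shows "(\<lambda>n. SUP x\<in>{sqrt (t * real n * ln (real n))..}.
           ereal \<bar>measure M {\<omega> \<in> space M. S n \<omega> \<in> (+) x ` Delta T}
                  / (real n * window F T x) - 1\<bar>) \<longlonglongrightarrow> 0"
proof -
  let ?f = "window F T"
  have T: "0 < T" by fact
  interpret prob_space M by fact
  have rv: "\<xi> 0 \<in> borel_measurable M" using assms(3) by (auto simp: indep_vars_def)
  have F: "F = distr M borel (\<xi> 0)" using assms(4) by simp
  interpret iid_walk M F \<xi>
  proof (intro iid_walk.intro iid_walk_axioms.intro real_distribution_second_moment.intro
      real_distribution_second_moment_axioms.intro)
    show "prob_space F" unfolding F by (rule prob_space_distr) (rule rv)
    show "integrable F (\<lambda>u. u)" "integrable F (\<lambda>u. u\<^sup>2)"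
      unfolding F using assms(6,8) by (simp_all add: integrable_distr_eq[OF rv])
    show "(\<integral>u. u \<partial>F) = 0" "(\<integral>u. u\<^sup>2 \<partial>F) = 1"
      unfolding F using assms(7,9) by (simp_all add: integral_distr[OF rv])
  qed (use assms F in auto)
  define q :: real where "q = (if T = \<infinity> then 0 else 1)"
  have idx: "upper_Matuszewska_index ?f < ereal (- 2 - q)" "- lower_Matuszewska_index ?f - ereal (2 + q) < ereal t"
    using assms(11-14) by (cases "T = \<infinity>"; simp add: q_def less_top)+
  obtain a where a: "\<And>x. x \<ge> a \<Longrightarrow> 0 < ?f x"
    using assms(10) unfolding intermediate_regularly_varying_def pos_measurable_near_infinity_def by blast
  obtain \<alpha> where \<alpha>: "upper_Matuszewska_index ?f < ereal \<alpha>" "\<alpha> < - 2 - q"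
    using ereal_dense2[OF idx(1)] by auto
  have "ereal (- (t + 2 + q)) < lower_Matuszewska_index ?f"
    using idx(2) by (cases "lower_Matuszewska_index ?f") auto
  then obtain p where p: "ereal p < lower_Matuszewska_index ?f" "- (t + 2 + q) < p"
    using ereal_dense2 by force
  define b where "b = - p"
  obtain K where K: "K > 0" "\<forall>\<^sub>F x in at_top. \<forall>y\<ge>1. ?f (x * y) \<le> K * y powr \<alpha> * ?f x"
    using upper_Matuszewska_potter[OF a \<alpha>(1)] by blast
  obtain D where D: "D > 0" "\<forall>\<^sub>F x in at_top. \<forall>y\<ge>1. D * y powr p * ?f x \<le> ?f (x * y)"
    using lower_Matuszewska_potter[OF a p(1)] by blast
  have "\<forall>\<^sub>F x in at_top. 1 \<le> x \<and> 0 < ?f x \<and> (\<forall>y\<ge>1. ?f (x * y) \<le> K * y powr \<alpha> * ?f x) \<and>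
      (\<forall>y\<ge>1. D * y powr (- b) * ?f x \<le> ?f (x * y))"
    using K(2) D(2) eventually_ge_at_top[of "max 1 a"]
    by eventually_elim (use a in \<open>auto simp: b_def\<close>)
  then obtain X where X: "\<And>x. X \<le> x \<Longrightarrow> 1 \<le> x" "\<And>x. X \<le> x \<Longrightarrow> 0 < ?f x"
    "\<And>x y. X \<le> x \<Longrightarrow> 1 \<le> y \<Longrightarrow> ?f (x * y) \<le> K * y powr \<alpha> * ?f x"
    "\<And>x y. X \<le> x \<Longrightarrow> 1 \<le> y \<Longrightarrow> D * y powr (- b) * ?f x \<le> ?f (x * y)"
    unfolding eventually_at_top_linorder by blast
  \<comment> \<open>The upper and lower power bounds would contradict each other for large
    \<open>y\<close> otherwise. With \<open>\<alpha> < - 2 - q\<close> this gives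
    \<open>b > 2 + q\<close>, and then \<open>b < t + 2 + q\<close> yields
    \<open>t > 0\<close>.\<close>
  have "- \<alpha> \<le> b"
  proof (rule ccontr)
    assume "\<not> - \<alpha> \<le> b"
    then have "((\<lambda>y. K * y powr (\<alpha> + b)) \<longlongrightarrow> 0) at_top"
      by real_asymp
    then have "\<forall>\<^sub>F y in at_top. K * y powr (\<alpha> + b) < D"
      using D by (intro order_tendstoD(2)) auto
    with eventually_ge_at_top[of 1] have "\<forall>\<^sub>F y :: real in at_top. False"
    proof eventually_elim
      case (elim y)
      have "D * y powr (- b) * ?f X \<le> K * y powr \<alpha> * ?f X"
        using X(3)[of X y] X(4)[of X y] elim by linarith
      then have "D * y powr (- b) \<le> K * y powr \<alpha>" using X(2)[of X] by simp
      then show False using elim by (simp add: powr_add powr_minus field_simps)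
    qed
    then show False by simp
  qed
  moreover have "0 \<le> q" by (simp add: q_def)
  ultimately have b: "0 < b" "b < t + 2 + q" "0 < t" using \<alpha> p by (auto simp: b_def)
  have uniform: "\<forall>\<^sub>F n in sequentially. \<forall>x\<ge>sqrt (t * real n * ln (real n)).
      \<bar>measure M {\<omega> \<in> space M. S n \<omega> \<in> (+) x ` Delta T} / (real n * ?f x) - 1\<bar> \<le> 3 * e"
    if "0 < e" "e < 1" for e
    unfolding S_def
    using big_jump_uniform[OF T q_def X(1)[OF order_refl] X(2) assms(10) X(3) K(1) \<alpha>(2) X(4) D(1) b that]
    by simp
  show ?thesis
  proof (rule order_tendstoI)
    fix a :: ereal assume "a < 0"
    then show "\<forall>\<^sub>F n in sequentially. a < (SUP x\<in>{sqrt (t * real n * ln (real n))..}.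
        ereal \<bar>measure M {\<omega> \<in> space M. S n \<omega> \<in> (+) x ` Delta T} / (real n * ?f x) - 1\<bar>)"
      \<comment> \<open>The supremum is over a nonempty set of nonnegative values, so the left end
        point is a witness.\<close>
      by (intro always_eventually allI, intro less_SUP_iff[THEN iffD2] bexI[of _ "sqrt (t * real n * ln (real n))" for n])
        (auto intro: less_le_trans)
  next
    fix a :: ereal assume "0 < a"
    then obtain e where e: "0 < ereal e" "ereal e < a" using ereal_dense2 by blast
    \<comment> \<open>The third matches the error \<open>3 * e'\<close>; the cap keeps
      \<open>e'\<close> below 1.\<close>
    define e' where "e' = min (1 / 2) (e / 3)"
    have e': "0 < e'" "e' < 1" "3 * e' \<le> e" using e by (auto simp: e'_def)
    show "\<forall>\<^sub>F n in sequentially. (SUP x\<in>{sqrt (t * real n * ln (real n))..}.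
        ereal \<bar>measure M {\<omega> \<in> space M. S n \<omega> \<in> (+) x ` Delta T} / (real n * ?f x) - 1\<bar>) < a"
      using uniform[OF e'(1,2)]
    proof eventually_elim
      case (elim n)
      have "(SUP x\<in>{sqrt (t * real n * ln (real n))..}.
        ereal \<bar>measure M {\<omega> \<in> space M. S n \<omega> \<in> (+) x ` Delta T} / (real n * ?f x) - 1\<bar>) \<le> ereal e"
      proof (rule SUP_least)
        fix x assume "x \<in> {sqrt (t * real n * ln (real n))..}"
        then have "\<bar>measure M {\<omega> \<in> space M. S n \<omega> \<in> (+) x ` Delta T} / (real n * ?f x) - 1\<bar> \<le> 3 * e'"
          using elim by simp
        then show "ereal \<bar>measure M {\<omega> \<in> space M. S n \<omega> \<in> (+) x ` Delta T} / (real n * ?f x) - 1\<bar> \<le> ereal e"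
          using e' by simp
      qed
      then show ?case using e(2) by (rule le_less_trans)
    qed
  qed
qed

end
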